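(* In games with objective $\mathrm{LowerUpper}(U,0)$ and in games with objective $\mathrm{LowerUpper}(U,0)\cap\mathrm{AvgEnergy}(t)$, with arbitrary energy upper bound $U\in\mathbb{N}$, pseudo-polynomial-memory strategies are both sufficient and necessary to win, for both players. That is: (i) whenever a player has a winning strategy, he has a finite-memory winning strategy whose number of memory states is bounded by a polynomial in $|S|$ and in the value $U$; and (ii) for each player there exist families of such games, parametrized by $U$, with a fixed number of states and weights of absolute value at most $U$, in which this player has a winning strategy but every winning strategy of this player needs a number of memory states growing with the value $U$ (so memory polynomial in the binary encoding size of the game does not suffice). Moreover, polynomial memory (in the size of the game) suffices when $U$ is polynomial in the size of the game or encoded in unary.
   Context: A game is a tuple $G=(S_1,S_2,E,w)$ where $S_1,S_2$ are disjoint finite sets of states (belonging to player 1 and player 2 respectively), $S=S_1\uplus S_2$, $E\subseteq S\times S$ is a set of edges such that every $s\in S$ has at least one $s'$ with $(s,s')\in E$, and $w\colon E\to\mathbb{Z}$ is a weight function. A play from $s_{init}$ is an infinite sequence $\pi=s_0s_1\dots$ with $s_0=s_{init}$ and $(s_i,s_{i+1})\in E$; $\pi(n)=s_0\dots s_n$. Energy level $\mathrm{EL}(\pi(n))=\sum_{i=0}^{n-1}w(s_i,s_{i+1})$; average-energy $\overline{\mathrm{AE}}(\pi)=\limsup_{n\to\infty}\frac1n\sum_{i=1}^{n}\mathrm{EL}(\pi(i))$. A strategy of player $i$ maps each finite prefix whose last state is in $S_i$ to a successor of that state. A strategy is finite-memory if it is implemented by a deterministic Moore machine $(M,m_0,\alpha_u,\alpha_n)$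 with finite memory set $M$, initial memory $m_0$, update function $\alpha_u\colon M\times S\to M$ and next-move function $\alpha_n\colon M\times S_i\to S$; its memory size is $|M|$. Player 1 wins with a strategy from $s_{init}$ for objective $\mathcal{W}$ if all consistent plays lie in $\mathcal{W}$; player 2 wins with a strategy if no consistent play lies in $\mathcal{W}$. Objectives: $\mathrm{AvgEnergy}(t)=\{\pi\mid\overline{\mathrm{AE}}(\pi)\le t\}$ and $\mathrm{LowerUpper}(U,c_{init})=\{\pi\mid\forall n\ge0,\ c_{init}+\mathrm{EL}(\pi(n))\in[0,U]\}$. *)

theory Defs
  imports
    "HOL-Analysis.Analysis"
    "HOL-Computational_Algebra.Polynomial"
    "HOL-Library.Log_Nat"
begin

record 'a game =
  states1 :: "'a set"
  states2 :: "'a set"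
  edges :: "('a \<times> 'a) set"
  weight :: "'a \<times> 'a \<Rightarrow> int"

definition states :: "'a game \<Rightarrow> 'a set" where
  "states G = states1 G \<union> states2 G"

definition is_game :: "'a game \<Rightarrow> bool" where
  "is_game G \<longleftrightarrow>
     finite (states1 G) \<and> finite (states2 G) \<and> states1 G \<inter> states2 G = {} \<and>
     edges G \<subseteq> states G \<times> states G \<and>
     (\<forall>s\<in>states G. \<exists>s'. (s, s') \<in> edges G)"

datatype player = Player1 | Player2

fun owned :: "'a game \<Rightarrow> player \<Rightarrow> 'a set" where
  "owned G Player1 = states1 G"
| "owned G Player2 = states2 G"

definition is_play :: "'a game \<Rightarrow> 'a \<Rightarrow> (nat \<Rightarrow> 'a) \<Rightarrow> bool" where
  "is_play G s \<pi> \<longleftrightarrow> \<pi> 0 = s \<and> (\<forall>n. (\<pi> n, \<pi> (Suc n)) \<in> edges G)"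

text \<open>The prefix up to and including position \<open>n\<close>, hence of length \<open>n + 1\<close>.\<close>

definition prefix_upto :: "(nat \<Rightarrow> 'a) \<Rightarrow> nat \<Rightarrow> 'a list" where
  "prefix_upto \<pi> n = map \<pi> [0..<Suc n]"

definition energy_level :: "'a game \<Rightarrow> (nat \<Rightarrow> 'a) \<Rightarrow> nat \<Rightarrow> int" where
  "energy_level G \<pi> n = (\<Sum>i<n. weight G (\<pi> i, \<pi> (Suc i)))"

definition average_energy :: "'a game \<Rightarrow> (nat \<Rightarrow> 'a) \<Rightarrow> ereal" where
  "average_energy G \<pi> =
     limsup (\<lambda>n. ereal (1 / real n * (\<Sum>i = 1..n. real_of_int (energy_level G \<pi> i))))"

definition AvgEnergy :: "'a game \<Rightarrow> real \<Rightarrow> (nat \<Rightarrow> 'a) set" where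
  "AvgEnergy G t = {\<pi>. average_energy G \<pi> \<le> ereal t}"

definition LowerUpper :: "'a game \<Rightarrow> nat \<Rightarrow> nat \<Rightarrow> (nat \<Rightarrow> 'a) set" where
  "LowerUpper G U c = {\<pi>. \<forall>n. int c + energy_level G \<pi> n \<in> {0..int U}}"

definition is_strategy :: "'a game \<Rightarrow> player \<Rightarrow> 'a \<Rightarrow> ('a list \<Rightarrow> 'a) \<Rightarrow> bool" where
  "is_strategy G i s \<sigma> \<longleftrightarrow>
     (\<forall>\<pi> n. is_play G s \<pi> \<and> \<pi> n \<in> owned G i \<longrightarrow> (\<pi> n, \<sigma> (prefix_upto \<pi> n)) \<in> edges G)"

definition consistent :: "'a game \<Rightarrow> player \<Rightarrow> ('a list \<Rightarrow> 'a) \<Rightarrow> (nat \<Rightarrow> 'a) \<Rightarrow> bool" where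
  "consistent G i \<sigma> \<pi> \<longleftrightarrow>
     (\<forall>n. \<pi> n \<in> owned G i \<longrightarrow> \<pi> (Suc n) = \<sigma> (prefix_upto \<pi> n))"

text \<open>The set \<open>W\<close> is always the objective of player 1; player 2 has the complementary objective.\<close>

fun achieves :: "player \<Rightarrow> (nat \<Rightarrow> 'a) set \<Rightarrow> (nat \<Rightarrow> 'a) \<Rightarrow> bool" where
  "achieves Player1 W \<pi> \<longleftrightarrow> \<pi> \<in> W"
| "achieves Player2 W \<pi> \<longleftrightarrow> \<pi> \<notin> W"

definition wins_with ::
    "'a game \<Rightarrow> player \<Rightarrow> 'a \<Rightarrow> (nat \<Rightarrow> 'a) set \<Rightarrow> ('a list \<Rightarrow> 'a) \<Rightarrow> bool" where
  "wins_with G i s W \<sigma> \<longleftrightarrow>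
     is_strategy G i s \<sigma> \<and>
     (\<forall>\<pi>. is_play G s \<pi> \<and> consistent G i \<sigma> \<pi> \<longrightarrow> achieves i W \<pi>)"

text \<open>
  Memory states are natural numbers, which is no restriction since the memory is finite.
\<close>

record 'a moore =
  memory :: "nat set"
  init_mem :: nat
  update :: "nat \<Rightarrow> 'a \<Rightarrow> nat"
  next_move :: "nat \<Rightarrow> 'a \<Rightarrow> 'a"

definition is_moore :: "'a game \<Rightarrow> player \<Rightarrow> 'a moore \<Rightarrow> bool" where
  "is_moore G i A \<longleftrightarrow>
     finite (memory A) \<and> init_mem A \<in> memory A \<and>
     (\<forall>m\<in>memory A. \<forall>s\<in>states G. update A m s \<in> memory A) \<and>
     (\<forall>m\<in>memory A. \<forall>s\<in>owned G i. next_move A m s \<in> states G)"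

text \<open>
  The memory is updated with a state when the play leaves it: the move chosen in the last state
  of a prefix depends on that state and on the memory reached by reading all earlier states.
\<close>

definition moore_strategy :: "'a moore \<Rightarrow> 'a list \<Rightarrow> 'a" where
  "moore_strategy A \<rho> =
     next_move A (foldl (update A) (init_mem A) (butlast \<rho>)) (last \<rho>)"

definition fm_wins_with ::
    "'a game \<Rightarrow> player \<Rightarrow> 'a \<Rightarrow> (nat \<Rightarrow> 'a) set \<Rightarrow> 'a moore \<Rightarrow> bool" where
  "fm_wins_with G i s W A \<longleftrightarrow> is_moore G i A \<and> wins_with G i s W (moore_strategy A)"

definition bounded_objectives :: "'a game \<Rightarrow> nat \<Rightarrow> (nat \<Rightarrow> 'a) set set" where
  "bounded_objectives G U =
     insert (LowerUpper G U 0) (range (\<lambda>t. LowerUpper G U 0 \<inter> AvgEnergy G t))"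

text \<open>
  Encoding sizes, with numbers in binary (one extra bit for the sign). Counting every state and
  edge as one unit instead of spelling out state names changes the size only polynomially.
\<close>

definition int_bits :: "int \<Rightarrow> nat" where
  "int_bits z = 1 + nat (bitlen \<bar>z\<bar>)"

definition rat_bits :: "rat \<Rightarrow> nat" where
  "rat_bits r = int_bits (fst (quotient_of r)) + int_bits (snd (quotient_of r))"

definition game_size :: "'a game \<Rightarrow> nat" where
  "game_size G = card (states G) + card (edges G) + (\<Sum>e\<in>edges G. int_bits (weight G e))"

text \<open>Bivariate polynomials are univariate ones over a univariate polynomial ring.\<close>

definition poly2 :: "nat poly poly \<Rightarrow> nat \<Rightarrow> nat \<Rightarrow> nat" where
  "poly2 P x y = poly (poly P [:x:]) y"

end

theory Submission
  imports Defs
begin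

text \<open>
  Recording the energy level next to the state turns both objectives into a mean-payoff objective
  on a finite arena with \<open>|S| (U + 1) + 1\<close> vertices, one of them a sink of large cost for the runs
  that leave \<open>{0..U}\<close>. Mean-payoff games are positionally determined, and a positional strategy in
  the arena is a Moore machine that remembers one vertex. Determinacy is proved by covering the
  arena with the domains of two potential functions, one per player, by induction on the number of
  edges: if a vertex \<open>v\<close> of the opponent has several successors, its edges are divided into two
  parts, and the potentials \<open>f\<^sub>a\<close> and \<open>f\<^sub>b\<close> of the two smaller arenas combine to
  \<open>min (f\<^sub>a + f\<^sub>b v) (f\<^sub>b + f\<^sub>a v)\<close>.

  For the lower bounds, a self-loop of weight 1 must be counted up to exactly \<open>U\<close>: by player 1 to
  leave it at the right time, or by player 2 to answer an exit of player 1 by an edge that pushes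
  the energy below 0 or above \<open>U\<close>.
\<close>

section \<open>Potentials for mean-payoff games\<close>

text \<open>An energy progress measure: if the owner follows the promised moves, telescoping shows
  that the sums of \<open>\<rho>\<close> along a play from \<open>u\<close> never fall below
  \<open>- f u\<close>. The flag \<open>strict\<close> allows the same lemmas to be used for both
  players.\<close>

definition potential ::
    "bool \<Rightarrow> 'v set \<Rightarrow> ('v \<times> 'v) set \<Rightarrow> ('v \<Rightarrow> real) \<Rightarrow> 'v set \<Rightarrow> ('v \<Rightarrow> real) \<Rightarrow> bool" where
  "potential strict own E \<rho> D f \<longleftrightarrow>
     (let R = (\<lambda>u u'. u' \<in> D \<and> (if strict then f u' < f u + \<rho> u else f u' \<le> f u + \<rho> u)) in
      \<forall>u\<in>D. 0 \<le> f u \<and>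
        (if u \<in> own then \<exists>u'. (u, u') \<in> E \<and> R u u' else \<forall>u'. (u, u') \<in> E \<longrightarrow> R u u'))"

text \<open>Edges of \<open>E\<close> missing from \<open>E'\<close> start at vertices of
  \<open>own\<close>, where they merely add options: one good successor is enough there, and it
  survives.\<close>

lemma potential_own_mono:
  assumes "potential strict own E' \<rho> D f" "E' \<subseteq> E"
    and "\<And>u u'. (u, u') \<in> E \<Longrightarrow> u \<notin> own \<Longrightarrow> (u, u') \<in> E'"
  shows "potential strict own E \<rho> D f"
  unfolding potential_def Let_def
proof (intro ballI conjI)
  fix u assume u: "u \<in> D"
  show "0 \<le> f u"
    using assms(1) u by (simp add: potential_def Let_def)
  show "if u \<in> own then \<exists>u'. (u, u') \<in> E \<and> u' \<in> D \<and>
      (if strict then f u' < f u + \<rho> u else f u' \<le> f u + \<rho> u)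
    else \<forall>u'. (u, u') \<in> E \<longrightarrow> u' \<in> D \<and>
      (if strict then f u' < f u + \<rho> u else f u' \<le> f u + \<rho> u)"
    using bspec[OF assms(1)[unfolded potential_def Let_def] u] assms(2) assms(3)[of u]
    by (auto split: if_splits)
qed

text \<open>The defining condition inspects only edges that leave vertices of \<open>D\<close>, so
  changing the edges at \<open>v\<close> cannot break it.\<close>

lemma potential_off_domain:
  assumes "potential strict own E' \<rho> D f" "v \<notin> D"
    and "\<And>u u'. u \<noteq> v \<Longrightarrow> (u, u') \<in> E \<longleftrightarrow> (u, u') \<in> E'"
  shows "potential strict own E \<rho> D f"
  unfolding potential_def Let_def
proof
  fix u assume u: "u \<in> D"
  then have "(u, u') \<in> E \<longleftrightarrow> (u, u') \<in> E'" for u'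
    using assms by metis
  then show "0 \<le> f u \<and>
    (if u \<in> own then \<exists>u'. (u, u') \<in> E \<and> u' \<in> D \<and>
      (if strict then f u' < f u + \<rho> u else f u' \<le> f u + \<rho> u)
    else \<forall>u'. (u, u') \<in> E \<longrightarrow> u' \<in> D \<and>
      (if strict then f u' < f u + \<rho> u else f u' \<le> f u + \<rho> u))"
    using bspec[OF assms(1)[unfolded potential_def Let_def] u] by simp
qed

text \<open>
  A play that visits \<open>v\<close> splits into the rounds leaving \<open>v\<close> along the two edge sets; each family
  of rounds is controlled by its own potential, whose value at \<open>v\<close> is kept in reserve during the
  rounds of the other family.
\<close>

lemma potential_combine:
  assumes a: "potential strict own Ea \<rho> Da fa" and b: "potential strict own Eb \<rho> Db fb"
    and v: "v \<in> Da" "v \<in> Db" "v \<notin> own"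
    and Ea: "\<And>u u'. u \<noteq> v \<Longrightarrow> (u, u') \<in> E \<longleftrightarrow> (u, u') \<in> Ea"
    and Eb: "\<And>u u'. u \<noteq> v \<Longrightarrow> (u, u') \<in> E \<longleftrightarrow> (u, u') \<in> Eb"
    and E: "\<And>u'. (v, u') \<in> E \<Longrightarrow> (v, u') \<in> Ea \<or> (v, u') \<in> Eb"
  shows "\<exists>f. potential strict own E \<rho> (Da \<union> Db) f"
proof -
  \<comment> \<open>\<open>A\<close> selects the branch that attains the minimum. A vertex in only
    one of the two domains takes the branch of that domain, since the other potential says nothing
    there.\<close>
  define A where "A u \<longleftrightarrow> u \<in> Da \<and> (u \<notin> Db \<or> fa u + fb v \<le> fb u + fa v)" for u
  define F where "F u = (if A u then fa u + fb v else fb u + fa v)" for u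
  have Fa: "F u \<le> fa u + fb v" if "u \<in> Da" for u
    using that by (auto simp: F_def A_def)
  have Fb: "F u \<le> fb u + fa v" if "u \<in> Db" for u
    using that by (auto simp: F_def A_def)
  have Fv: "F v = fa v + fb v"
    by (auto simp: F_def)
  have nonneg: "0 \<le> fa u" if "u \<in> Da" for u using a that by (auto simp: potential_def Let_def)
  have nonneg': "0 \<le> fb u" if "u \<in> Db" for u using b that by (auto simp: potential_def Let_def)
  define R where "R u u' \<longleftrightarrow> u' \<in> Da \<union> Db \<and>
      (if strict then F u' < F u + \<rho> u else F u' \<le> F u + \<rho> u)" for u u'
  define Ra where "Ra u u' \<longleftrightarrow> u' \<in> Da \<and>
      (if strict then fa u' < fa u + \<rho> u else fa u' \<le> fa u + \<rho> u)" for u u'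
  define Rb where "Rb u u' \<longleftrightarrow> u' \<in> Db \<and>
      (if strict then fb u' < fb u + \<rho> u else fb u' \<le> fb u + \<rho> u)" for u u'
  \<comment> \<open>The successor may take its value from the other branch, but by \<open>Fa\<close>
    this can only lower \<open>F u'\<close>.\<close>
  have RaR: "R u u'" if "Ra u u'" "F u = fa u + fb v" for u u'
    using that Fa[of u'] by (auto simp: R_def Ra_def split: if_splits)
  have RbR: "R u u'" if "Rb u u'" "F u = fb u + fa v" for u u'
    using that Fb[of u'] by (auto simp: R_def Rb_def split: if_splits)
  have a': "if u \<in> own then \<exists>u'. (u, u') \<in> Ea \<and> Ra u u' else \<forall>u'. (u, u') \<in> Ea \<longrightarrow> Ra u u'"
    if "u \<in> Da" for u
    using a that unfolding potential_def Let_def Ra_def by blast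
  have b': "if u \<in> own then \<exists>u'. (u, u') \<in> Eb \<and> Rb u u' else \<forall>u'. (u, u') \<in> Eb \<longrightarrow> Rb u u'"
    if "u \<in> Db" for u
    using b that unfolding potential_def Let_def Rb_def by blast
  have "0 \<le> F u \<and> (if u \<in> own then \<exists>u'. (u, u') \<in> E \<and> R u u' else \<forall>u'. (u, u') \<in> E \<longrightarrow> R u u')"
    if u: "u \<in> Da \<union> Db" for u
  proof
    show "0 \<le> F u"
      using u nonneg[of u] nonneg'[of u] nonneg[of v] nonneg'[of v] v by (auto simp: F_def A_def)
    show "if u \<in> own then \<exists>u'. (u, u') \<in> E \<and> R u u' else \<forall>u'. (u, u') \<in> E \<longrightarrow> R u u'"
    proof (cases "u = v")
      case True
      \<comment> \<open>At \<open>v\<close> both branches have the same value, so an edge from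
        either part can be handled by the potential of its own part.\<close>
      have "R v u'" if "(v, u') \<in> E" for u'
        using E[OF that] a'[of v] b'[of v] v RaR[of v u'] RbR[of v u'] Fv by auto
      then show ?thesis
        using True v by simp
    next
      case False
      show ?thesis
      proof (cases "A u")
        case True
        then show ?thesis
          using a'[of u] RaR[of u] Ea[OF False] by (auto simp: A_def F_def split: if_splits)
      next
        case nA: False
        then have "u \<in> Db"
          using u by (auto simp: A_def)
        then show ?thesis
          using b'[of u] RbR[of u] Eb[OF False] nA by (auto simp: F_def split: if_splits)
      qed
    qed
  qed
  then have "potential strict own E \<rho> (Da \<union> Db) F"
    unfolding potential_def Let_def R_def by blast
  then show ?thesis
    by blast
qed

text \<open>
  With \<open>st = False\<close>, \<open>st' = True\<close> and \<open>\<rho>' = - \<rho>\<close>: from \<open>X\<close> the player of \<open>own\<close> keeps the sums of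
  \<open>\<rho>\<close> bounded below, and from \<open>Y\<close> his opponent makes these sums decrease linearly.
\<close>

definition covered ::
    "bool \<Rightarrow> bool \<Rightarrow> 'v set \<Rightarrow> ('v \<times> 'v) set \<Rightarrow> ('v \<Rightarrow> real) \<Rightarrow> ('v \<Rightarrow> real) \<Rightarrow> bool" where
  "covered st st' own E \<rho> \<rho>' \<longleftrightarrow>
     (\<exists>X Y f g. Domain E \<subseteq> X \<union> Y \<and> potential st own E \<rho> X f \<and> potential st' (- own) E \<rho>' Y g)"

lemma covered_swap: "covered st st' own E \<rho> \<rho>' \<Longrightarrow> covered st' st (- own) E \<rho>' \<rho>"
  unfolding covered_def by (simp add: Un_commute) blast

text \<open>If both domains of the owner contain \<open>v\<close>, his potentials combine, and
  \<open>Ya\<close> covers the rest. If one of them misses \<open>v\<close>, that smaller arena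
  already gives a cover of \<open>E\<close>: its potential for the owner never looks at
  \<open>v\<close>.\<close>

lemma covered_split:
  assumes a: "covered st st' own Ea \<rho> \<rho>'" and b: "covered st st' own Eb \<rho> \<rho>'"
    and v: "v \<notin> own"
    and Ea: "\<And>u u'. u \<noteq> v \<Longrightarrow> (u, u') \<in> E \<longleftrightarrow> (u, u') \<in> Ea"
    and Eb: "\<And>u u'. u \<noteq> v \<Longrightarrow> (u, u') \<in> E \<longleftrightarrow> (u, u') \<in> Eb"
    and E: "E = Ea \<union> Eb"
    and dom: "Domain Ea = Domain E" "Domain Eb = Domain E"
  shows "covered st st' own E \<rho> \<rho>'"
proof -
  obtain Xa Ya fa ga where A: "Domain Ea \<subseteq> Xa \<union> Ya" "potential st own Ea \<rho> Xa fa"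
    "potential st' (- own) Ea \<rho>' Ya ga"
    using a unfolding covered_def by blast
  obtain Xb Yb fb gb where B: "Domain Eb \<subseteq> Xb \<union> Yb" "potential st own Eb \<rho> Xb fb"
    "potential st' (- own) Eb \<rho>' Yb gb"
    using b unfolding covered_def by blast
  \<comment> \<open>Here \<open>v\<close> belongs to the opponent, so the edges restored at
    \<open>v\<close> only give him more choice.\<close>
  have Ya: "potential st' (- own) E \<rho>' Ya ga"
  proof (rule potential_own_mono[OF A(3)])
    show "Ea \<subseteq> E"
      using E by blast
    show "(u, u') \<in> Ea" if "(u, u') \<in> E" "u \<notin> - own" for u u'
      using that v Ea by (metis ComplI)
  qed
  have Yb: "potential st' (- own) E \<rho>' Yb gb"
  proof (rule potential_own_mono[OF B(3)])
    show "Eb \<subseteq> E"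
      using E by blast
    show "(u, u') \<in> Eb" if "(u, u') \<in> E" "u \<notin> - own" for u u'
      using that v Eb by (metis ComplI)
  qed
  show ?thesis
  proof (cases "v \<in> Xa \<and> v \<in> Xb")
    case True
    then obtain f where "potential st own E \<rho> (Xa \<union> Xb) f"
      using potential_combine[OF A(2) B(2), of v E] v Ea Eb E by blast
    moreover have "Domain E \<subseteq> (Xa \<union> Xb) \<union> Ya"
      using A(1) dom by auto
    ultimately show ?thesis
      using Ya unfolding covered_def by blast
  next
    case False
    then show ?thesis
    proof (cases "v \<in> Xa")
      case True
      then have "v \<notin> Xb"
        using False by simp
      then have "potential st own E \<rho> Xb fb"
        using potential_off_domain[OF B(2)] Eb by blast
      then show ?thesis
        using Yb B(1) dom unfolding covered_def by auto
    next
      case False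
      then have "potential st own E \<rho> Xa fa"
        using potential_off_domain[OF A(2)] Ea by blast
      then show ?thesis
        using Ya A(1) dom unfolding covered_def by auto
    qed
  qed
qed

text \<open>The case without choices. Let \<open>X\<close> collect the vertices whose partial sums
  of \<open>\<rho>\<close> are bounded below; the smallest sufficient credit is a potential. From
  every other vertex the sums become negative again and again, and finiteness makes this happen at a
  uniform rate.\<close>

lemma functional_potentials:
  fixes T :: "'v \<Rightarrow> 'v" and \<rho> :: "'v \<Rightarrow> real"
  assumes fin: "finite V" and T: "\<And>u. u \<in> V \<Longrightarrow> T u \<in> V"
  shows "\<exists>X Y f g. V = X \<union> Y \<and>
    (\<forall>u\<in>X. 0 \<le> f u \<and> T u \<in> X \<and> f (T u) \<le> f u + \<rho> u) \<and>
    (\<forall>u\<in>Y. 0 \<le> g u \<and> T u \<in> Y \<and> g (T u) < g u - \<rho> u)"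
proof -
  define S where "S n u = (\<Sum>i<n. \<rho> ((T ^^ i) u))" for n u
  have S0: "S 0 u = 0" for u
    by (simp add: S_def)
  have SSuc: "S (Suc n) u = \<rho> u + S n (T u)" for n u
    by (simp add: S_def sum.lessThan_Suc_shift funpow_swap1 del: sum.lessThan_Suc)
  have Sadd: "S (m + n) u = S m u + S n ((T ^^ m) u)" for m n u
    by (induction m arbitrary: u) (simp_all add: S0 SSuc funpow_swap1)
  define X where "X = {u \<in> V. \<exists>B. \<forall>n. - S n u \<le> B}"
  \<comment> \<open>The least initial credit; the empty sum \<open>n = 0\<close> makes it
    nonnegative.\<close>
  define f where "f u = (SUP n. - S n u)" for u
  have bdd: "bdd_above (range (\<lambda>n. - S n u))" if "u \<in> X" for u
    using that by (auto simp: X_def bdd_above_def)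
  have 1: "0 \<le> f u \<and> T u \<in> X \<and> f (T u) \<le> f u + \<rho> u" if u: "u \<in> X" for u
  proof (intro conjI)
    show "0 \<le> f u"
      unfolding f_def using cSUP_upper[OF _ bdd[OF u], of 0] by (simp add: S0)
    have le: "- S n (T u) \<le> f u + \<rho> u" for n
      unfolding f_def using cSUP_upper[OF _ bdd[OF u], of "Suc n"] by (simp add: SSuc)
    then show "T u \<in> X"
      using u T by (auto simp: X_def)
    show "f (T u) \<le> f u + \<rho> u"
      unfolding f_def[of "T u"] by (rule cSUP_least) (use le in auto)
  qed
  define Y where "Y = V - X"
  have finY: "finite Y"
    using fin by (simp add: Y_def)
  have TY: "T u \<in> Y" if u: "u \<in> Y" for u
  proof (rule ccontr)
    assume "T u \<notin> Y"
    then obtain B where B: "\<And>n. - S n (T u) \<le> B"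
      using u T by (auto simp: X_def Y_def)
    have "- S n u \<le> \<bar>B\<bar> + \<bar>\<rho> u\<bar>" for n
      using B[of "n - 1"] by (cases n) (auto simp: S0 SSuc)
    then show False
      using u by (auto simp: X_def Y_def)
  qed
  have TYn: "(T ^^ n) u \<in> Y" if "u \<in> Y" for n u
    using that by (induction n) (auto intro: TY)
  have "\<forall>u\<in>Y. \<exists>n. S n u < 0"
    
  proof
    fix u assume "u \<in> Y"
    \<comment> \<open>Outside \<open>X\<close> every bound fails, in particular the bound 0.\<close>
    then have "\<not> (\<forall>n. - S n u \<le> 0)"
      unfolding X_def Y_def by blast
    then show "\<exists>n. S n u < 0"
      by (auto simp: not_le)
  qed
  then obtain N where N: "\<And>u. u \<in> Y \<Longrightarrow> S (N u) u < 0"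
    by metis
  have Npos: "0 < N u" if "u \<in> Y" for u
    using N[OF that] S0[of u] by (cases "N u") auto
  \<comment> \<open>A rate of decrease valid for all \<open>u\<close> in \<open>Y\<close> over
    blocks of \<open>N u\<close> steps; inserting 1 keeps the minimum defined when \<open>Y\<close>
    is empty.\<close>
  define \<delta> where "\<delta> = Min (insert 1 ((\<lambda>u. - S (N u) u / N u) ` Y))"
  have \<delta>pos: "0 < \<delta>"
    unfolding \<delta>_def using finY N Npos by (subst Min_gr_iff) (auto intro!: divide_neg_pos)
  have \<delta>: "S (N u) u + \<delta> * N u \<le> 0" if "u \<in> Y" for u
  proof -
    have "\<delta> \<le> - S (N u) u / N u"
      unfolding \<delta>_def using finY that by (intro Min_le) auto
    then show ?thesis
      using Npos[OF that] by (simp add: field_simps)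
  qed
  \<comment> \<open>After adding the drift \<open>\<delta>\<close> per step, whole blocks contribute
    at most 0, so only the values within a single block need to be bounded.\<close>
  define B where "B = Max (insert 0 (\<Union>u\<in>Y. (\<lambda>n. S n u + \<delta> * n) ` {..N u}))"
  have "S n u + \<delta> * n \<le> B" if "u \<in> Y" for n u
    using that
  proof (induction n arbitrary: u rule: less_induct)
    case (less n)
    show ?case
    proof (cases "n \<le> N u")
      case True
      then show ?thesis
        unfolding B_def using finY less.prems by (intro Max_ge) auto
    next
      case False
      then obtain k where k: "n = N u + k" "k < n"
        using Npos[OF less.prems] by (metis less_add_same_cancel2 less_imp_add_positive not_le)
      have "S k ((T ^^ N u) u) + \<delta> * k \<le> B"
        using less.IH[OF k(2)] TYn[OF less.prems] by blast
      then show ?thesis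
        using \<delta>[OF less.prems] Sadd[of "N u" k u] by (simp add: k(1) algebra_simps)
    qed
  qed
  then have bdd': "bdd_above (range (\<lambda>n. S n u + \<delta> * n))" if "u \<in> Y" for u
    using that by (auto simp: bdd_above_def)
  \<comment> \<open>The supremum of the drifted sums: shifting by one step costs an additional
    \<open>\<delta>\<close>, and this is what makes the inequality strict.\<close>
  define g where "g u = (SUP n. S n u + \<delta> * real n)" for u
  have 2: "0 \<le> g u \<and> T u \<in> Y \<and> g (T u) < g u - \<rho> u" if u: "u \<in> Y" for u
  proof (intro conjI)
    show "0 \<le> g u"
      unfolding g_def using cSUP_upper[OF _ bdd'[OF u], of 0] by (simp add: S0)
    show "T u \<in> Y"
      by (rule TY[OF u])
    have le: "S n (T u) + \<delta> * n \<le> g u - \<rho> u - \<delta>" for n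
      unfolding g_def using cSUP_upper[OF _ bdd'[OF u], of "Suc n"]
      by (simp add: SSuc algebra_simps)
    have "g (T u) \<le> g u - \<rho> u - \<delta>"
      unfolding g_def[of "T u"] by (rule cSUP_least) (use le in auto)
    then show "g (T u) < g u - \<rho> u"
      using \<delta>pos by simp
  qed
  have "V = X \<union> Y"
    by (auto simp: X_def Y_def)
  then show ?thesis
    using 1 2 by (intro exI[of _ X] exI[of _ Y] exI[of _ f] exI[of _ g]) auto
qed

theorem mean_payoff_potentials:
  assumes "finite E" "Range E \<subseteq> Domain E"
  shows "covered False True own E \<rho> (\<lambda>u. - \<rho> u)"
  using assms
proof (induction "card E" arbitrary: E rule: less_induct)
  case less
  show ?case
  proof (cases "\<exists>v a b. (v, a) \<in> E \<and> (v, b) \<in> E \<and> a \<noteq> b")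
    case False
    define T where "T u = (SOME u'. (u, u') \<in> E)" for u
    have TE: "(u, T u) \<in> E" if "u \<in> Domain E" for u
      using that unfolding T_def by (auto intro: someI)
    have T: "u' = T u" if "(u, u') \<in> E" for u u'
      using that TE[of u] False by blast
    have "T u \<in> Domain E" if "u \<in> Domain E" for u
      using TE[OF that] less.prems(2) by auto
    then obtain X Y f g where XY: "Domain E = X \<union> Y"
      "\<forall>u\<in>X. 0 \<le> f u \<and> T u \<in> X \<and> f (T u) \<le> f u + \<rho> u"
      "\<forall>u\<in>Y. 0 \<le> g u \<and> T u \<in> Y \<and> g (T u) < g u - \<rho> u"
      using functional_potentials[of "Domain E" T \<rho>] less.prems(1) finite_Domain by metis
    have "potential False own E \<rho> X f"
      unfolding potential_def Let_def using XY TE T by (auto 0 4)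
    moreover have "potential True (- own) E (\<lambda>u. - \<rho> u) Y g"
      unfolding potential_def Let_def using XY TE T by (auto 0 4)
    ultimately show ?thesis
      using XY(1) unfolding covered_def by blast
  next
    case True
    then obtain v a b where ab: "(v, a) \<in> E" "(v, b) \<in> E" "a \<noteq> b"
      by blast
    \<comment> \<open>At \<open>v\<close>, the first part loses only the edge to \<open>b\<close>
      and the second keeps only that edge. Both parts are smaller, and no vertex loses its last
      successor.\<close>
    define Ea where "Ea = E - {(v, b)}"
    define Eb where "Eb = E - {v} \<times> (- {b})"
    have dom: "Domain Ea = Domain E" "Domain Eb = Domain E"
      using ab by (auto simp: Ea_def Eb_def)
    have sub: "Ea \<subset> E" "Eb \<subset> E"
      using ab by (auto simp: Ea_def Eb_def)
    have IH: "covered False True own E' \<rho> (\<lambda>u. - \<rho> u)"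
      if "E' \<subset> E" "Domain E' = Domain E" for E'
    proof (rule less.hyps)
      show "card E' < card E"
        using that less.prems by (intro psubset_card_mono)
      show "finite E'"
        using that less.prems by (auto intro: finite_subset)
      show "Range E' \<subseteq> Domain E'"
        using that less.prems(2) by (metis Range_mono order_trans psubset_imp_subset)
    qed
    note hyps = IH[OF sub(1) dom(1)] IH[OF sub(2) dom(2)]
    have "E = Ea \<union> Eb"
      by (auto simp: Ea_def Eb_def)
    note split = covered_split[where v = v, OF _ _ _ _ _ this dom]
    show ?thesis
    proof (cases "v \<in> own")
      case False
      show ?thesis
        by (rule split[OF hyps False]) (auto simp: Ea_def Eb_def)
    next
      case True
      \<comment> \<open>The splitting lemma requires \<open>v\<close> to belong to the opponent, so
        the two players exchange roles and are exchanged back afterwards.\<close>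
      have "covered True False (- own) E (\<lambda>u. - \<rho> u) \<rho>"
        by (rule split[OF hyps[THEN covered_swap]]) (use True in \<open>auto simp: Ea_def Eb_def\<close>)
      then show ?thesis
        using covered_swap by fastforce
    qed
  qed
qed

section \<open>Plays and strategies\<close>

lemma play_states:
  assumes "is_game G" "is_play G s \<pi>" "s \<in> states G"
  shows "\<pi> n \<in> states G"
  using assms by (cases n) (auto simp: is_game_def is_play_def)

lemma owned_states: "owned G i \<subseteq> states G"
  by (cases i) (auto simp: states_def)

lemma prefix_upto_cong: "(\<And>k. k \<le> n \<Longrightarrow> \<pi> k = \<pi>' k) \<Longrightarrow> prefix_upto \<pi> n = prefix_upto \<pi>' n"
  by (simp add: prefix_upto_def)

lemma prefix_upto_Suc: "prefix_upto \<pi> (Suc n) = prefix_upto \<pi> n @ [\<pi> (Suc n)]"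
  by (simp add: prefix_upto_def)

lemma last_prefix_upto [simp]: "last (prefix_upto \<pi> n) = \<pi> n"
  by (simp add: prefix_upto_def)

lemma length_prefix_upto [simp]: "length (prefix_upto \<pi> n) = Suc n"
  by (simp add: prefix_upto_def)

lemma butlast_prefix_upto [simp]:
  "butlast (prefix_upto \<pi> n) = (if n = 0 then [] else prefix_upto \<pi> (n - 1))"
  by (cases n) (simp_all add: prefix_upto_def butlast_append)

lemma prefix_upto_const: "(\<And>k. k \<le> n \<Longrightarrow> \<pi> k = a) \<Longrightarrow> prefix_upto \<pi> n = replicate (Suc n) a"
  by (auto simp: prefix_upto_def intro!: nth_equalityI simp del: upt_Suc replicate_Suc)

lemma energy_level_Suc:
  "energy_level G \<pi> (Suc n) = energy_level G \<pi> n + weight G (\<pi> n, \<pi> (Suc n))"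
  by (simp add: energy_level_def)

lemma energy_level_0 [simp]: "energy_level G \<pi> 0 = 0"
  by (simp add: energy_level_def)

text \<open>\<open>is_strategy\<close> guarantees legal moves only on prefixes of infinite plays, so
  a finite path has to be continued before the guarantee can be used. Every state has a successor,
  and iterating one choice of successors continues it.\<close>

lemma finite_path_extends_to_play:
  assumes G: "is_game G" and s: "\<pi> 0 = s" "s \<in> states G"
    and path: "\<And>k. k < n \<Longrightarrow> (\<pi> k, \<pi> (Suc k)) \<in> edges G"
  shows "\<exists>\<pi>'. is_play G s \<pi>' \<and> (\<forall>k\<le>n. \<pi>' k = \<pi> k)"
proof -
  define d where "d q = (SOME q'. (q, q') \<in> edges G)" for q
  have d: "(q, d q) \<in> edges G" if "q \<in> states G" for q
    using that G unfolding d_def is_game_def by (metis someI_ex)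
  have edges: "q' \<in> states G" if "(q, q') \<in> edges G" for q q'
    using that G by (auto simp: is_game_def)
  have \<pi>n: "\<pi> k \<in> states G" if "k \<le> n" for k
    using that s edges[OF path] by (cases k) auto
  have dn: "(d ^^ k) (\<pi> n) \<in> states G" for k
    by (induction k) (use \<pi>n edges[OF d] in auto)
  define \<pi>' where "\<pi>' k = (if k \<le> n then \<pi> k else (d ^^ (k - n)) (\<pi> n))" for k
  have "(\<pi>' k, \<pi>' (Suc k)) \<in> edges G" for k
  proof -
    consider "k < n" | "k \<ge> n"
      by linarith
    then show ?thesis
    proof cases
      case 2
      then have "\<pi>' k = (d ^^ (k - n)) (\<pi> n)" "\<pi>' (Suc k) = d ((d ^^ (k - n)) (\<pi> n))"
        by (auto simp: \<pi>'_def Suc_diff_le)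
      then show ?thesis
        using d dn by simp
    qed (use path in \<open>simp add: \<pi>'_def\<close>)
  qed
  then have "is_play G s \<pi>'"
    using s by (simp add: is_play_def \<pi>'_def)
  moreover have "\<forall>k\<le>n. \<pi>' k = \<pi> k"
    by (simp add: \<pi>'_def)
  ultimately show ?thesis
    by blast
qed

lemma consistent_play_exists:
  assumes G: "is_game G" and s: "s \<in> states G"
    and \<sigma>: "is_strategy G Player1 s \<sigma>\<^sub>1" "is_strategy G Player2 s \<sigma>\<^sub>2"
  shows "\<exists>\<pi>. is_play G s \<pi> \<and> consistent G Player1 \<sigma>\<^sub>1 \<pi> \<and> consistent G Player2 \<sigma>\<^sub>2 \<pi>"
proof -
  \<comment> \<open>\<open>L n\<close> is the whole history up to position \<open>n\<close>, because
    strategies read histories.\<close>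
  define L where
    "L = rec_nat [s] (\<lambda>_ \<rho>. \<rho> @ [if last \<rho> \<in> states1 G then \<sigma>\<^sub>1 \<rho> else \<sigma>\<^sub>2 \<rho>])"
  define \<pi> where "\<pi> n = last (L n)" for n
  have \<pi>_Suc: "\<pi> (Suc n) = (if \<pi> n \<in> states1 G then \<sigma>\<^sub>1 (L n) else \<sigma>\<^sub>2 (L n))"
    and L_Suc: "L (Suc n) = L n @ [\<pi> (Suc n)]" for n
    by (simp_all add: \<pi>_def L_def)
  have L: "L n = prefix_upto \<pi> n" for n
  proof (induction n)
    case 0
    then show ?case
      by (simp add: L_def \<pi>_def prefix_upto_def)
  next
    case (Suc n)
    then show ?case
      by (simp only: L_Suc prefix_upto_Suc)
  qed
  note next_state = \<pi>_Suc[unfolded L]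
  have \<pi>0: "\<pi> 0 = s"
    by (simp add: \<pi>_def L_def)
  \<comment> \<open>Strong induction: the edges before position \<open>n\<close> form a path that
    extends to a play, on whose prefix the moving strategy is known to be legal.\<close>
  have edge: "(\<pi> n, \<pi> (Suc n)) \<in> edges G" for n
  proof (induction n rule: less_induct)
    case (less n)
    then obtain \<pi>' where \<pi>': "is_play G s \<pi>'" "\<And>k. k \<le> n \<Longrightarrow> \<pi>' k = \<pi> k"
      using finite_path_extends_to_play[where \<pi> = \<pi> and n = n, OF G \<pi>0 s] by metis
    have "prefix_upto \<pi>' n = prefix_upto \<pi> n" "\<pi>' n = \<pi> n"
      using \<pi>'(2) by (auto intro: prefix_upto_cong)
    moreover have "\<pi>' n \<in> states G"
      by (rule play_states[OF G \<pi>'(1) s])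
    ultimately show ?case
      using \<sigma> \<pi>'(1) next_state[of n] unfolding is_strategy_def states_def
      by (metis UnE owned.simps)
  qed
  have "is_play G s \<pi>"
    using \<pi>0 edge by (simp add: is_play_def)
  moreover have "consistent G Player1 \<sigma>\<^sub>1 \<pi>" "consistent G Player2 \<sigma>\<^sub>2 \<pi>"
    using next_state G by (auto simp: consistent_def is_game_def)
  ultimately show ?thesis
    by blast
qed

lemma not_both_win:
  assumes "is_game G" "s \<in> states G" "wins_with G Player1 s W \<sigma>\<^sub>1" "wins_with G Player2 s W \<sigma>\<^sub>2"
  shows False
  using consistent_play_exists[of G s \<sigma>\<^sub>1 \<sigma>\<^sub>2] assms unfolding wins_with_def by auto

lemma strategy_exists:
  assumes "is_game G" "s \<in> states G"
  shows "\<exists>\<sigma>. is_strategy G i s \<sigma>"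
proof -
  have "\<forall>q\<in>states G. \<exists>q'. (q, q') \<in> edges G"
    using assms by (simp add: is_game_def)
  then obtain d where "\<And>q. q \<in> states G \<Longrightarrow> (q, d q) \<in> edges G"
    by metis
  then have "is_strategy G i s (\<lambda>\<rho>. d (last \<rho>))"
    using play_states[OF assms(1) _ assms(2)] by (auto simp: is_strategy_def)
  then show ?thesis
    by blast
qed

text \<open>Memory of any type is renamed along a bijection with an initial segment of the naturals.
  Agreement is claimed only for histories inside \<open>states G\<close>, where \<open>upd\<close>
  is known to stay in \<open>M\<close>.\<close>

lemma moore_from_finite_memory:
  fixes upd :: "'m \<Rightarrow> 'a \<Rightarrow> 'm" and nxt :: "'m \<Rightarrow> 'a \<Rightarrow> 'a"
  assumes M: "finite M" "m\<^sub>0 \<in> M" and upd: "\<And>m q. m \<in> M \<Longrightarrow> q \<in> states G \<Longrightarrow> upd m q \<in> M"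
    and nxt: "\<And>m q. m \<in> M \<Longrightarrow> q \<in> owned G i \<Longrightarrow> nxt m q \<in> states G"
  shows "\<exists>A. is_moore G i A \<and> card (memory A) = card M \<and>
    (\<forall>\<rho>. set (butlast \<rho>) \<subseteq> states G \<longrightarrow>
       moore_strategy A \<rho> = nxt (foldl upd m\<^sub>0 (butlast \<rho>)) (last \<rho>))"
proof -
  obtain h where h: "bij_betw h M {0..<card M}"
    using ex_bij_betw_finite_nat[OF M(1)] by blast
  define h' where "h' = inv_into M h"
  have h': "h' (h m) = m" if "m \<in> M" for m
    using h that by (simp add: h'_def bij_betw_inv_into_left)
  have h'M: "h' n \<in> M" if "n < card M" for n
    using h that bij_betwE[OF bij_betw_inv_into[OF h]] by (simp add: h'_def)
  have hM: "h m < card M" if "m \<in> M" for m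
    using bij_betwE[OF h] that by simp
  define A where "A = \<lparr>memory = {0..<card M}, init_mem = h m\<^sub>0,
    update = (\<lambda>n q. h (upd (h' n) q)), next_move = (\<lambda>n. nxt (h' n))\<rparr>"
  have A: "is_moore G i A"
    using M upd nxt h'M hM by (auto simp: is_moore_def A_def)
  have fold: "foldl upd m\<^sub>0 qs \<in> M \<and>
      foldl (update A) (init_mem A) qs = h (foldl upd m\<^sub>0 qs)" if "set qs \<subseteq> states G" for qs
    using that by (induction qs rule: rev_induct) (auto simp: A_def M h' upd)
  have "moore_strategy A \<rho> = nxt (foldl upd m\<^sub>0 (butlast \<rho>)) (last \<rho>)"
    if "set (butlast \<rho>) \<subseteq> states G" for \<rho>
    using fold[OF that] h' by (simp add: moore_strategy_def A_def)
  then show ?thesis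
    using A by (intro exI[of _ A]) (simp add: A_def)
qed

section \<open>The arena of states and energy levels\<close>

text \<open>
  A configuration \<open>None\<close> is the sink reached once the energy has left \<open>{0..U}\<close>.
\<close>

type_synonym 'a config = "('a \<times> int) option"

fun step :: "'a game \<Rightarrow> nat \<Rightarrow> 'a config \<Rightarrow> 'a \<Rightarrow> 'a config" where
  "step G U None q' = None"
| "step G U (Some (q, e)) q' =
     (let e' = e + weight G (q, q') in if e' \<in> {0..int U} then Some (q', e') else None)"

definition configs :: "'a game \<Rightarrow> nat \<Rightarrow> 'a config set" where
  "configs G U = insert None (Some ` (states G \<times> {0..int U}))"

definition arena :: "'a game \<Rightarrow> nat \<Rightarrow> ('a config \<times> 'a config) set" where
  "arena G U = insert (None, None)
     {(Some (q, e), step G U (Some (q, e)) q') | q e q'. (q, q') \<in> edges G \<and> e \<in> {0..int U}}"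

fun config_of :: "'a game \<Rightarrow> nat \<Rightarrow> (nat \<Rightarrow> 'a) \<Rightarrow> nat \<Rightarrow> 'a config" where
  "config_of G U \<pi> 0 = Some (\<pi> 0, 0)"
| "config_of G U \<pi> (Suc n) = step G U (config_of G U \<pi> n) (\<pi> (Suc n))"

section \<open>Finiteness and size of the arena\<close>

lemma step_in_configs: "q' \<in> states G \<Longrightarrow> step G U x q' \<in> configs G U"
  by (cases "(G, U, x, q')" rule: step.cases) (auto simp: configs_def Let_def)

lemma arena_subset: "is_game G \<Longrightarrow> arena G U \<subseteq> configs G U \<times> configs G U"
  by (auto simp: arena_def is_game_def intro!: step_in_configs simp del: step.simps)
    (auto simp: configs_def)

lemma finite_configs: "is_game G \<Longrightarrow> finite (configs G U)"
  by (simp add: configs_def is_game_def states_def)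

lemma finite_arena: "is_game G \<Longrightarrow> finite (arena G U)"
  using arena_subset finite_configs by (metis finite_SigmaI finite_subset)

lemma card_configs:
  assumes "is_game G"
  shows "card (configs G U) = card (states G) * (U + 1) + 1"
proof -
  have "finite (states G)"
    using assms by (simp add: is_game_def states_def)
  then show ?thesis
    by (simp add: configs_def card_image card_cartesian_product nat_add_distrib)
qed

lemma Domain_arena: "is_game G \<Longrightarrow> Domain (arena G U) = configs G U"
  using arena_subset[of G U]
  by (auto simp: configs_def arena_def is_game_def simp del: step.simps) (blast dest: SigmaD1)

section \<open>The run of the arena along a play\<close>

lemma config_of_Some:
  assumes "config_of G U \<pi> n = Some (q, e)"
  shows "q = \<pi> n \<and> e = energy_level G \<pi> n \<and> e \<in> {0..int U}"
  using assms
proof (induction n arbitrary: q e)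
  case (Suc n)
  then show ?case
    by (cases "config_of G U \<pi> n") (auto simp: Let_def energy_level_Suc split: if_splits)
qed auto

lemma config_of_LowerUpper:
  "\<pi> \<in> LowerUpper G U 0 \<longleftrightarrow> (\<forall>n. config_of G U \<pi> n = Some (\<pi> n, energy_level G \<pi> n))"
proof
  assume *: "\<pi> \<in> LowerUpper G U 0"
  show "\<forall>n. config_of G U \<pi> n = Some (\<pi> n, energy_level G \<pi> n)"
  proof
    show "config_of G U \<pi> n = Some (\<pi> n, energy_level G \<pi> n)" for n
    proof (induction n)
      case (Suc n)
      have "energy_level G \<pi> (Suc n) \<in> {0..int U}"
        using * by (simp add: LowerUpper_def)
      then show ?case
        using Suc by (simp add: Let_def energy_level_Suc)
    qed simp
  qed
next
  assume "\<forall>n. config_of G U \<pi> n = Some (\<pi> n, energy_level G \<pi> n)"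
  then show "\<pi> \<in> LowerUpper G U 0"
    using config_of_Some by (fastforce simp: LowerUpper_def)
qed

lemma step_in_arena:
  assumes "x \<in> configs G U" "x = None \<or> (\<exists>e. x = Some (q, e))" "(q, q') \<in> edges G"
  shows "(x, step G U x q') \<in> arena G U"
  using assms unfolding arena_def configs_def by (cases x) (auto simp del: step.simps(2))

lemma config_of_in_arena:
  assumes "is_game G" "is_play G s \<pi>" "s \<in> states G"
  shows "(config_of G U \<pi> n, config_of G U \<pi> (Suc n)) \<in> arena G U"
proof -
  have "config_of G U \<pi> n \<in> configs G U"
    using play_states[OF assms] config_of_Some[of G U \<pi> n]
    by (cases "config_of G U \<pi> n") (auto simp: configs_def)
  then show ?thesis
    using config_of_Some[of G U \<pi> n] assms(2)
    by (cases "config_of G U \<pi> n") (auto intro!: step_in_arena[of _ _ _ "\<pi> n"] simp: is_play_def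
        simp del: step.simps)
qed

text \<open>
  A positional strategy in the arena becomes a Moore machine whose memory is the configuration
  reached before the current state (\<open>None\<close> at the start of the play).
\<close>

fun current :: "'a game \<Rightarrow> nat \<Rightarrow> 'a config option \<Rightarrow> 'a \<Rightarrow> 'a config" where
  "current G U None q = Some (q, 0)"
| "current G U (Some x) q = step G U x q"

text \<open>The relation \<open>R\<close> stands for the inequality of either player's potential, so
  one construction serves both. The sink has its own assumption because it records no state and
  hence no owner. The summand 2 counts the sink and the initial memory.\<close>

lemma moore_of_positional:
  assumes G: "is_game G" and s: "s \<in> states G"
    and init: "Some (s, 0) \<in> D"
    and own: "\<And>q e. Some (q, e) \<in> D \<Longrightarrow> q \<in> owned G i \<Longrightarrow> e \<in> {0..int U} \<Longrightarrow>
      \<exists>x'. (Some (q, e), x') \<in> arena G U \<and> R (Some (q, e)) x'"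
    and other: "\<And>q e x'. Some (q, e) \<in> D \<Longrightarrow> q \<in> states G - owned G i \<Longrightarrow>
      (Some (q, e), x') \<in> arena G U \<Longrightarrow> R (Some (q, e)) x'"
    and sink: "None \<in> D \<Longrightarrow> R None None"
    and R: "\<And>x x'. R x x' \<Longrightarrow> x' \<in> D"
  shows "\<exists>A. is_moore G i A \<and> card (memory A) = card (states G) * (U + 1) + 2 \<and>
    is_strategy G i s (moore_strategy A) \<and>
    (\<forall>\<pi>. is_play G s \<pi> \<and> consistent G i (moore_strategy A) \<pi> \<longrightarrow>
       (\<forall>n. config_of G U \<pi> n \<in> D \<and> R (config_of G U \<pi> n) (config_of G U \<pi> (Suc n))))"
proof -
  define good where "good x q q' \<longleftrightarrow> (q, q') \<in> edges G \<and> R x (step G U x q')" for x q q'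
  \<comment> \<open>Without a good successor an arbitrary edge is taken: \<open>is_strategy\<close>
    demands a legal move on every play, including those that leave \<open>D\<close>.\<close>
  define nxt where "nxt m q = (let x = current G U m q in
      if \<exists>q'. good x q q' then SOME q'. good x q q' else SOME q'. (q, q') \<in> edges G)" for m q
  have nxt_edge: "(q, nxt m q) \<in> edges G" if "q \<in> states G" for m q
  proof (cases "\<exists>q'. good (current G U m q) q q'")
    case True
    then show ?thesis
      unfolding nxt_def Let_def by (metis (mono_tags, lifting) good_def someI_ex)
  next
    case False
    moreover have "\<exists>q'. (q, q') \<in> edges G"
      using G that by (simp add: is_game_def)
    ultimately show ?thesis
      unfolding nxt_def Let_def by (metis (mono_tags, lifting) someI_ex)
  qed
  have nxt_R: "R (current G U m q) (step G U (current G U m q) (nxt m q))"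
    if "\<exists>q'. good (current G U m q) q q'" for m q
  proof -
    have "good (current G U m q) q (nxt m q)"
      using someI_ex[OF that] that by (simp add: nxt_def)
    then show ?thesis
      by (simp add: good_def)
  qed
  define M where "M = insert None (Some ` configs G U)"
  have finM: "finite M"
    using finite_configs[OF G] by (simp add: M_def)
  have cardM: "card M = card (states G) * (U + 1) + 2"
    using finite_configs[OF G, of U] card_configs[OF G, of U] by (simp add: M_def card_image)
  have upd: "Some (current G U m q) \<in> M" if "q \<in> states G" for m q
  proof (cases m)
    case None
    then show ?thesis
      using that by (simp add: M_def configs_def image_iff)
  next
    case (Some x)
    then show ?thesis
      using that step_in_configs[of q G U x] by (simp add: M_def)
  qed
  have "nxt m q \<in> states G" if "q \<in> owned G i" for m q
    using nxt_edge[of q m] that owned_states[of G i] G by (auto simp: is_game_def)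
  then obtain A where A: "is_moore G i A" "card (memory A) = card M"
    and A_strat: "\<And>\<rho>. set (butlast \<rho>) \<subseteq> states G \<Longrightarrow>
      moore_strategy A \<rho> = nxt (foldl (\<lambda>m q. Some (current G U m q)) None (butlast \<rho>)) (last \<rho>)"
    using moore_from_finite_memory[of M None G "\<lambda>m q. Some (current G U m q)" i nxt] finM upd
    by (auto simp: M_def)
  \<comment> \<open>The memory lags one position behind, as it is updated only when a state is
    left.\<close>
  define mem where "mem \<pi> n = (if n = 0 then None else Some (config_of G U \<pi> (n - 1)))" for \<pi> n
  have fold: "foldl (\<lambda>m q. Some (current G U m q)) None (prefix_upto \<pi> n) =
      Some (config_of G U \<pi> n)" for \<pi> n
    by (induction n) (simp_all add: prefix_upto_Suc, simp add: prefix_upto_def)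
  have strat: "moore_strategy A (prefix_upto \<pi> n) = nxt (mem \<pi> n) (\<pi> n)"
    if "is_play G s \<pi>" for \<pi> n
  proof -
    have "set (butlast (prefix_upto \<pi> n)) \<subseteq> states G"
      using play_states[OF G that s] by (auto simp: prefix_upto_def)
    from A_strat[OF this] show ?thesis
      by (simp add: mem_def fold)
  qed
  have current_mem: "current G U (mem \<pi> n) (\<pi> n) = config_of G U \<pi> n" for \<pi> n
    by (cases n) (simp_all add: mem_def)
  have "is_strategy G i s (moore_strategy A)"
    unfolding is_strategy_def using strat nxt_edge play_states[OF G _ s] by auto
  moreover have "\<forall>n. config_of G U \<pi> n \<in> D \<and> R (config_of G U \<pi> n) (config_of G U \<pi> (Suc n))"
    if play: "is_play G s \<pi>" and con: "consistent G i (moore_strategy A) \<pi>" for \<pi>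
  proof -
    have R_step: "R (config_of G U \<pi> n) (config_of G U \<pi> (Suc n))" if D: "config_of G U \<pi> n \<in> D" for n
    proof (cases "config_of G U \<pi> n")
      case None
      then show ?thesis
        using sink D by simp
    next
      case (Some qe)
      then obtain e where e: "config_of G U \<pi> n = Some (\<pi> n, e)" "e \<in> {0..int U}"
        using config_of_Some[of G U \<pi> n] by (cases qe) auto
      show ?thesis
      proof (cases "\<pi> n \<in> owned G i")
        case True
        then obtain x' where "(Some (\<pi> n, e), x') \<in> arena G U" "R (Some (\<pi> n, e)) x'"
          using own[of "\<pi> n" e] D e by metis
        then have "\<exists>q'. good (config_of G U \<pi> n) (\<pi> n) q'"
          using e by (auto simp: arena_def good_def simp del: step.simps)
        moreover have "\<pi> (Suc n) = nxt (mem \<pi> n) (\<pi> n)"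
          using con True strat[OF play] by (simp add: consistent_def)
        ultimately show ?thesis
          using nxt_R[of "mem \<pi> n" "\<pi> n"] by (simp add: current_mem)
      next
        case False
        then show ?thesis
          using other[of "\<pi> n" e] D e play_states[OF G play s, of n]
            config_of_in_arena[OF G play s, of U n] by auto
      qed
    qed
    have "config_of G U \<pi> n \<in> D" for n
    proof (induction n)
      case 0
      then show ?case
        using init play by (simp add: is_play_def)
    next
      case (Suc n)
      then show ?case
        using R_step R by blast
    qed
    then show ?thesis
      using R_step by blast
  qed
  ultimately show ?thesis
    using A cardM by auto
qed

section \<open>Memory of linear size suffices\<close>

text \<open>
  Both kinds of objectives bound the limit superior average of a function of the energy level;
  for \<open>LowerUpper\<close> alone the function is constant.
\<close>

definition average_objective :: "'a game \<Rightarrow> nat \<Rightarrow> (int \<Rightarrow> real) \<Rightarrow> real \<Rightarrow> (nat \<Rightarrow> 'a) set" where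
  "average_objective G U \<kappa> t = {\<pi> \<in> LowerUpper G U 0.
     limsup (\<lambda>n. ereal (1 / real n * (\<Sum>i = 1..n. \<kappa> (energy_level G \<pi> i)))) \<le> ereal t}"

lemma bounded_objectives_average:
  assumes "W \<in> bounded_objectives G U"
  shows "\<exists>\<kappa> t. W = average_objective G U \<kappa> t"
proof -
  have "LowerUpper G U 0 = average_objective G U (\<lambda>_. 0) 0"
    by (auto simp: average_objective_def zero_ereal_def[symmetric] Limsup_const)
  moreover have "LowerUpper G U 0 \<inter> AvgEnergy G t = average_objective G U real_of_int t" for t
    by (auto simp: average_objective_def AvgEnergy_def average_energy_def)
  ultimately show ?thesis
    using assms unfolding bounded_objectives_def by blast
qed

text \<open>Telescoping \<open>h\<close> from position 1, where the averages start, bounds the sum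
  by \<open>n * t + h 1\<close>, and \<open>h 1 / n\<close> vanishes in the limit.\<close>

lemma average_le_of_potential:
  fixes a h :: "nat \<Rightarrow> real"
  assumes "\<And>n. 0 \<le> h n" "\<And>n. h (Suc n) \<le> h n + (t - a n)"
  shows "limsup (\<lambda>n. ereal (1 / real n * (\<Sum>i = 1..n. a i))) \<le> ereal t"
proof -
  have sum: "(\<Sum>i = 1..n. a i) \<le> real n * t + h 1 - h (Suc n)" for n
  proof (induction n)
    case (Suc n)
    then show ?case
      using assms(2)[of "Suc n"] by (simp add: algebra_simps)
  qed simp
  have "1 / real n * (\<Sum>i = 1..n. a i) \<le> t + h 1 / real n" if "n > 0" for n
    using sum[of n] assms(1)[of "Suc n"] that by (simp add: field_simps)
  then have "limsup (\<lambda>n. ereal (1 / real n * (\<Sum>i = 1..n. a i))) \<le>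
      limsup (\<lambda>n. ereal (t + h 1 / real n))"
    by (intro Limsup_mono eventually_mono[OF eventually_gt_at_top[of 0]]) auto
  also have "(\<lambda>n. t + h 1 / real n) \<longlonglongrightarrow> t + 0"
    by (intro tendsto_add tendsto_const lim_const_over_n)
  then have "limsup (\<lambda>n. ereal (t + h 1 / real n)) = ereal t"
    by (intro lim_imp_Limsup) simp_all
  finally show ?thesis .
qed

text \<open>The same telescoping in the other direction; the drift \<open>\<delta>\<close> survives
  in the limit and gives the strict inequality.\<close>

lemma average_gt_of_potential:
  fixes a h :: "nat \<Rightarrow> real"
  assumes "\<And>n. 0 \<le> h n" "\<And>n. h (Suc n) \<le> h n - (t - a n) - \<delta>" "0 < \<delta>"
  shows "limsup (\<lambda>n. ereal (1 / real n * (\<Sum>i = 1..n. a i))) > ereal t"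
proof -
  have sum: "(\<Sum>i = 1..n. a i) \<ge> real n * (t + \<delta>) + h (Suc n) - h 1" for n
  proof (induction n)
    case (Suc n)
    then show ?case
      using assms(2)[of "Suc n"] by (simp add: algebra_simps)
  qed simp
  have "t + \<delta> - h 1 / real n \<le> 1 / real n * (\<Sum>i = 1..n. a i)" if "n > 0" for n
  proof -
    have "t + \<delta> - h 1 / real n = (real n * (t + \<delta>) - h 1) / real n"
      using that by (simp add: field_simps)
    also have "\<dots> \<le> (\<Sum>i = 1..n. a i) / real n"
      using sum[of n] assms(1)[of "Suc n"] by (intro divide_right_mono) auto
    finally show ?thesis
      by simp
  qed
  then have le: "limsup (\<lambda>n. ereal (t + \<delta> - h 1 / real n)) \<le>
      limsup (\<lambda>n. ereal (1 / real n * (\<Sum>i = 1..n. a i)))"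
    by (intro Limsup_mono eventually_mono[OF eventually_gt_at_top[of 0]]) auto
  have "(\<lambda>n. t + \<delta> - h 1 / real n) \<longlonglongrightarrow> t + \<delta> - 0"
    by (intro tendsto_diff tendsto_const lim_const_over_n)
  then have "limsup (\<lambda>n. ereal (t + \<delta> - h 1 / real n)) = ereal (t + \<delta>)"
    by (intro lim_imp_Limsup) simp_all
  moreover have "ereal t < ereal (t + \<delta>)"
    using assms(3) by simp
  ultimately show ?thesis
    using le by (metis order.strict_trans2)
qed

text \<open>The cost of the sink exceeds the threshold, which keeps the sink out of player 1's region.\<close>

fun surplus :: "(int \<Rightarrow> real) \<Rightarrow> real \<Rightarrow> 'a config \<Rightarrow> real" where
  "surplus \<kappa> t None = - 1"
| "surplus \<kappa> t (Some (q, e)) = t - \<kappa> e"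

lemma None_arena: "(None, x) \<in> arena G U \<longleftrightarrow> x = None"
  by (auto simp: arena_def)

lemma player1_region_wins:
  assumes G: "is_game G" and s: "s \<in> states G"
    and pot: "potential False (Some ` (states1 G \<times> UNIV)) (arena G U) (surplus \<kappa> t) X f"
    and init: "Some (s, 0) \<in> X"
  shows "\<exists>A. fm_wins_with G Player1 s (average_objective G U \<kappa> t) A \<and>
    card (memory A) = card (states G) * (U + 1) + 2"
proof -
  define R where "R x x' \<longleftrightarrow> x' \<in> X \<and> f x' \<le> f x + surplus \<kappa> t x" for x x'
  have pot': "0 \<le> f x" "if x \<in> Some ` (states1 G \<times> UNIV) then \<exists>x'. (x, x') \<in> arena G U \<and> R x x'
      else \<forall>x'. (x, x') \<in> arena G U \<longrightarrow> R x x'" if "x \<in> X" for x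
    using pot that by (auto simp: potential_def Let_def R_def)
  \<comment> \<open>The self-loop of the sink would require
    \<open>f None \<le> f None - 1\<close>.\<close>
  have sink: "None \<notin> X"
  proof
    assume "None \<in> X"
    then have "R None None"
      using pot'(2)[of None] by (auto simp: None_arena)
    then show False
      by (simp add: R_def)
  qed
  have "\<exists>A. is_moore G Player1 A \<and> card (memory A) = card (states G) * (U + 1) + 2 \<and>
    is_strategy G Player1 s (moore_strategy A) \<and>
    (\<forall>\<pi>. is_play G s \<pi> \<and> consistent G Player1 (moore_strategy A) \<pi> \<longrightarrow>
       (\<forall>n. config_of G U \<pi> n \<in> X \<and> R (config_of G U \<pi> n) (config_of G U \<pi> (Suc n))))"
  proof (rule moore_of_positional[OF G s init])
    show "\<exists>x'. (Some (q, e), x') \<in> arena G U \<and> R (Some (q, e)) x'"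
      if "Some (q, e) \<in> X" "q \<in> owned G Player1" for q e
      using pot'(2)[OF that(1)] that(2) by (auto split: if_splits)
    show "R (Some (q, e)) x'"
      if "Some (q, e) \<in> X" "q \<in> states G - owned G Player1" "(Some (q, e), x') \<in> arena G U" for q e x'
      using pot'(2)[OF that(1)] that(2,3) by (auto split: if_splits)
  qed (use sink in \<open>auto simp: R_def\<close>)
  then obtain A where A: "is_moore G Player1 A" "card (memory A) = card (states G) * (U + 1) + 2"
      "is_strategy G Player1 s (moore_strategy A)"
    and inv: "\<And>\<pi> n. is_play G s \<pi> \<Longrightarrow> consistent G Player1 (moore_strategy A) \<pi> \<Longrightarrow>
       config_of G U \<pi> n \<in> X \<and> R (config_of G U \<pi> n) (config_of G U \<pi> (Suc n))"
    by blast
  have "\<pi> \<in> average_objective G U \<kappa> t"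
    if \<pi>: "is_play G s \<pi>" "consistent G Player1 (moore_strategy A) \<pi>" for \<pi>
  proof -
    have cfg: "config_of G U \<pi> n = Some (\<pi> n, energy_level G \<pi> n)" for n
      using inv[OF \<pi>, of n] sink config_of_Some[of G U \<pi> n] by (cases "config_of G U \<pi> n") auto
    then have "\<pi> \<in> LowerUpper G U 0"
      by (simp add: config_of_LowerUpper)
    moreover have "limsup (\<lambda>n. ereal (1 / real n * (\<Sum>i = 1..n. \<kappa> (energy_level G \<pi> i)))) \<le> ereal t"
    proof (rule average_le_of_potential)
      show "0 \<le> f (config_of G U \<pi> n)" for n
        using inv[OF \<pi>, of n] pot'(1) by blast
      show "f (config_of G U \<pi> (Suc n)) \<le>
          f (config_of G U \<pi> n) + (t - \<kappa> (energy_level G \<pi> n))" for n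
        using inv[OF \<pi>, of n] cfg[of n] by (simp add: R_def del: config_of.simps)
    qed
    ultimately show ?thesis
      by (simp add: average_objective_def)
  qed
  then show ?thesis
    using A by (auto simp: fm_wins_with_def wins_with_def)
qed

text \<open>A play that reaches the sink violates the energy bounds. A play that never does so has a
  strictly dropping potential, which pushes its average above \<open>t\<close>.\<close>

lemma player2_region_wins:
  assumes G: "is_game G" and s: "s \<in> states G"
    and pot: "potential True (- Some ` (states1 G \<times> UNIV)) (arena G U) (\<lambda>x. - surplus \<kappa> t x) Y g"
    and init: "Some (s, 0) \<in> Y"
  shows "\<exists>A. fm_wins_with G Player2 s (average_objective G U \<kappa> t) A \<and>
    card (memory A) = card (states G) * (U + 1) + 2"
proof -
  define R where "R x x' \<longleftrightarrow> x' \<in> Y \<and> g x' < g x - surplus \<kappa> t x" for x x'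
  have pot': "0 \<le> g x" "if x \<in> Some ` (states1 G \<times> UNIV)
      then \<forall>x'. (x, x') \<in> arena G U \<longrightarrow> R x x' else \<exists>x'. (x, x') \<in> arena G U \<and> R x x'"
    if "x \<in> Y" for x
    using pot that by (auto simp: potential_def Let_def R_def)
  have "\<exists>A. is_moore G Player2 A \<and> card (memory A) = card (states G) * (U + 1) + 2 \<and>
    is_strategy G Player2 s (moore_strategy A) \<and>
    (\<forall>\<pi>. is_play G s \<pi> \<and> consistent G Player2 (moore_strategy A) \<pi> \<longrightarrow>
       (\<forall>n. config_of G U \<pi> n \<in> Y \<and> R (config_of G U \<pi> n) (config_of G U \<pi> (Suc n))))"
  proof (rule moore_of_positional[OF G s init])
    show "\<exists>x'. (Some (q, e), x') \<in> arena G U \<and> R (Some (q, e)) x'"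
      if "Some (q, e) \<in> Y" "q \<in> owned G Player2" for q e
    proof -
      have "q \<notin> states1 G"
        using G that(2) by (auto simp: is_game_def)
      then show ?thesis
        using pot'(2)[OF that(1)] by (auto split: if_splits)
    qed
    show "R (Some (q, e)) x'"
      if "Some (q, e) \<in> Y" "q \<in> states G - owned G Player2" "(Some (q, e), x') \<in> arena G U" for q e x'
      using pot'(2)[OF that(1)] that(2,3) by (auto simp: states_def split: if_splits)
    show "R None None" if "None \<in> Y"
      using pot'(2)[OF that] by (auto simp: None_arena)
  qed (auto simp: R_def)
  then obtain A where A: "is_moore G Player2 A" "card (memory A) = card (states G) * (U + 1) + 2"
      "is_strategy G Player2 s (moore_strategy A)"
    and inv: "\<And>\<pi> n. is_play G s \<pi> \<Longrightarrow> consistent G Player2 (moore_strategy A) \<pi> \<Longrightarrow>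
       config_of G U \<pi> n \<in> Y \<and> R (config_of G U \<pi> n) (config_of G U \<pi> (Suc n))"
    by blast
  \<comment> \<open>Strict decrease alone gives no positive rate; the finitely many arena edges
    supply a least gap.\<close>
  define gaps where "gaps = (\<lambda>(x, x'). g x - surplus \<kappa> t x - g x') ` {(x, x') \<in> arena G U. R x x'}"
  define \<delta> where "\<delta> = Min (insert 1 gaps)"
  have fin: "finite gaps"
    unfolding gaps_def using finite_arena[OF G] by (auto intro: finite_subset)
  have "0 < \<delta>"
    unfolding \<delta>_def using fin by (subst Min_gr_iff) (auto simp: gaps_def R_def)
  have \<delta>: "g x' \<le> g x - surplus \<kappa> t x - \<delta>" if "(x, x') \<in> arena G U" "R x x'" for x x'
  proof -
    have "\<delta> \<le> g x - surplus \<kappa> t x - g x'"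
      unfolding \<delta>_def using fin that by (intro Min_le) (auto simp: gaps_def)
    then show ?thesis
      by simp
  qed
  have "\<pi> \<notin> average_objective G U \<kappa> t"
    if \<pi>: "is_play G s \<pi>" "consistent G Player2 (moore_strategy A) \<pi>" for \<pi>
  proof
    assume "\<pi> \<in> average_objective G U \<kappa> t"
    then have cfg: "\<And>n. config_of G U \<pi> n = Some (\<pi> n, energy_level G \<pi> n)"
      and le: "limsup (\<lambda>n. ereal (1 / real n * (\<Sum>i = 1..n. \<kappa> (energy_level G \<pi> i)))) \<le> ereal t"
      by (simp_all add: average_objective_def config_of_LowerUpper)
    have "limsup (\<lambda>n. ereal (1 / real n * (\<Sum>i = 1..n. \<kappa> (energy_level G \<pi> i)))) > ereal t"
    proof (rule average_gt_of_potential[OF _ _ \<open>0 < \<delta>\<close>])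
      show "0 \<le> g (config_of G U \<pi> n)" for n
        using inv[OF \<pi>, of n] pot'(1) by blast
      show "g (config_of G U \<pi> (Suc n)) \<le>
          g (config_of G U \<pi> n) - (t - \<kappa> (energy_level G \<pi> n)) - \<delta>" for n
        using inv[OF \<pi>, of n] cfg[of n] \<delta>[OF config_of_in_arena[OF G \<pi>(1) s, of U n]]
        by (simp del: config_of.simps)
    qed
    then show False
      using le by simp
  qed
  then show ?thesis
    using A by (auto simp: fm_wins_with_def wins_with_def)
qed

text \<open>The initial configuration lies in the region of some player \<open>j\<close>, who then
  has a machine of this size. Since two winning strategies would produce a contradictory play,
  \<open>j\<close> is the player assumed to win.\<close>

theorem finite_memory_suffices:
  assumes G: "is_game G" and s: "s \<in> states G" and W: "W \<in> bounded_objectives G U"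
    and win: "wins_with G i s W \<sigma>"
  shows "\<exists>A. fm_wins_with G i s W A \<and> card (memory A) = card (states G) * (U + 1) + 2"
proof -
  obtain \<kappa> t where W: "W = average_objective G U \<kappa> t"
    using bounded_objectives_average[OF W] by blast
  have dom: "Domain (arena G U) = configs G U" "Range (arena G U) \<subseteq> configs G U"
    using Domain_arena[OF G] arena_subset[OF G] by auto
  have "covered False True (Some ` (states1 G \<times> UNIV)) (arena G U) (surplus \<kappa> t)
      (\<lambda>x. - surplus \<kappa> t x)"
    using dom by (intro mean_payoff_potentials finite_arena[OF G]) simp
  then obtain X Y f g where XY: "configs G U \<subseteq> X \<union> Y"
    and X: "potential False (Some ` (states1 G \<times> UNIV)) (arena G U) (surplus \<kappa> t) X f"
    and Y: "potential True (- Some ` (states1 G \<times> UNIV)) (arena G U) (\<lambda>x. - surplus \<kappa> t x) Y g"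
    unfolding covered_def dom(1) by blast
  have "Some (s, 0) \<in> configs G U"
    using s by (auto simp: configs_def)
  then obtain j A where A: "fm_wins_with G j s W A"
      "card (memory A) = card (states G) * (U + 1) + 2"
    using XY player1_region_wins[OF G s X] player2_region_wins[OF G s Y] unfolding W by blast
  have "i = j"
    using not_both_win[OF G s] win A(1) unfolding fm_wins_with_def
    by (cases i; cases j) auto
  then show ?thesis
    using A by blast
qed

section \<open>Games in which the energy level must be counted\<close>

text \<open>If two of the first \<open>U + 1\<close> memory states coincided, running on from the
  earlier one would reach the \<open>U\<close>-th memory state too soon, and \<open>Q\<close> would
  already hold there.\<close>

lemma counting_needs_memory:
  assumes "finite M" "x \<in> M" "\<And>m. m \<in> M \<Longrightarrow> u m \<in> M"
    and Q: "\<And>j. j \<le> U \<Longrightarrow> Q ((u ^^ j) x) \<longleftrightarrow> j = U"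
  shows "U + 1 \<le> card M"
proof -
  have "(u ^^ i) x \<noteq> (u ^^ j) x" if "i < j" "j \<le> U" for i j
  proof
    assume "(u ^^ i) x = (u ^^ j) x"
    then have "(u ^^ (U - j + i)) x = (u ^^ (U - j + j)) x"
      by (simp only: funpow_add o_apply)
    then have "(u ^^ (U - j + i)) x = (u ^^ U) x"
      using that by simp
    moreover have "U - j + i < U"
      using that by arith
    ultimately show False
      using Q[of U] Q[of "U - j + i"] by (metis less_imp_le_nat less_not_refl order_refl)
  qed
  then have "inj_on (\<lambda>j. (u ^^ j) x) {..U}"
    by (intro linorder_inj_onI) auto
  moreover have "(u ^^ j) x \<in> M" for j
    by (induction j) (use assms(2,3) in auto)
  ultimately have "card {..U} \<le> card M"
    using assms(1) by (intro card_inj_on_le[of "\<lambda>j. (u ^^ j) x"]) auto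
  then show ?thesis
    by simp
qed

lemma foldl_replicate: "foldl u x (replicate n a) = ((\<lambda>m. u m a) ^^ n) x"
  by (induction n arbitrary: x) (simp_all add: funpow_Suc_right del: funpow.simps(2))

lemma energy_level_const:
  assumes "\<And>k. k \<le> n \<Longrightarrow> \<pi> k = a"
  shows "energy_level G \<pi> n = int n * weight G (a, a)"
  using assms by (simp add: energy_level_def)

text \<open>Player 1 has to leave state 0 exactly when the energy level is \<open>U\<close>.\<close>

definition counting_game1 :: "nat \<Rightarrow> nat game" where
  "counting_game1 U = \<lparr>states1 = {0}, states2 = {1}, edges = {(0, 0), (0, 1), (1, 1)},
     weight = (\<lambda>e. if e = (0, 0) then 1 else if e = (0, 1) then - int U else 0)\<rparr>"

lemma is_game_counting_game1: "is_game (counting_game1 U)"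
  by (auto simp: is_game_def counting_game1_def states_def)

lemma counting_game1_win:
  "\<exists>\<sigma>. wins_with (counting_game1 U) Player1 0 (LowerUpper (counting_game1 U) U 0) \<sigma>"
proof -
  define G where "G = counting_game1 U"
  \<comment> \<open>The prefix at position \<open>n\<close> has length \<open>n + 1\<close>, so the
    first move to 1 is made at position \<open>U\<close>, with energy \<open>U\<close>.\<close>
  define \<sigma> :: "nat list \<Rightarrow> nat" where "\<sigma> \<rho> = (if length \<rho> \<le> U then 0 else 1)" for \<rho>
  have "is_strategy G Player1 0 \<sigma>"
    by (auto simp: is_strategy_def G_def counting_game1_def \<sigma>_def)
  moreover have "\<pi> \<in> LowerUpper G U 0" if "is_play G 0 \<pi>" "consistent G Player1 \<sigma> \<pi>" for \<pi>
  proof -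
    have edge: "\<pi> 0 = 0" "(\<pi> n, \<pi> (Suc n)) \<in> {(0, 0), (0, 1), (1, 1)}" for n
      using that(1) by (simp_all add: is_play_def G_def counting_game1_def)
    have con: "\<pi> (Suc n) = (if Suc n \<le> U then 0 else 1)" if "\<pi> n = 0" for n
      using \<open>consistent G Player1 \<sigma> \<pi>\<close> that
      by (simp add: consistent_def G_def counting_game1_def \<sigma>_def)
    have \<pi>: "\<pi> n = (if n \<le> U then 0 else 1)" for n
    proof (induction n)
      case (Suc n)
      then show ?case
        using edge(2)[of n] con[of n] by (auto split: if_splits)
    qed (simp add: edge)
    have "energy_level G \<pi> n = (if n \<le> U then int n else 0)" for n
      by (induction n) (auto simp: energy_level_Suc \<pi> G_def counting_game1_def)
    then show ?thesis
      by (simp add: LowerUpper_def)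
  qed
  ultimately show ?thesis
    by (auto simp: wins_with_def G_def)
qed

text \<open>Leaving early makes the energy negative and staying too long exceeds \<open>U\<close>,
  so the play is forced. While the machine reads only zeros, its move must therefore change exactly
  after \<open>U\<close> of them.\<close>

lemma counting_game1_memory:
  assumes "fm_wins_with (counting_game1 U) Player1 0 (LowerUpper (counting_game1 U) U 0) A"
  shows "U + 1 \<le> card (memory A)"
proof -
  define G where "G = counting_game1 U"
  have A: "is_moore G Player1 A" "is_strategy G Player1 0 (moore_strategy A)"
    and win: "\<And>\<pi>. is_play G 0 \<pi> \<Longrightarrow> consistent G Player1 (moore_strategy A) \<pi> \<Longrightarrow>
      \<pi> \<in> LowerUpper G U 0"
    using assms by (auto simp: fm_wins_with_def wins_with_def G_def)
  have G: "is_game G" "0 \<in> states G"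
    using is_game_counting_game1 by (auto simp: G_def states_def counting_game1_def)
  obtain \<sigma> where "is_strategy G Player2 0 \<sigma>"
    using strategy_exists[OF G] by blast
  then obtain \<pi> where play: "is_play G 0 \<pi>" and con: "consistent G Player1 (moore_strategy A) \<pi>"
    using consistent_play_exists[OF G A(2)] by blast
  have LU: "energy_level G \<pi> n \<in> {0..int U}" for n
    using win[OF play con] by (simp add: LowerUpper_def)
  have edge: "\<pi> 0 = 0" "(\<pi> n, \<pi> (Suc n)) \<in> {(0, 0), (0, 1), (1, 1)}" for n
    using play by (simp_all add: is_play_def G_def counting_game1_def)
  have zero: "\<forall>k\<le>n. \<pi> k = 0" if "n \<le> U" for n
    using that
  proof (induction n)
    case (Suc n)
    then have IH: "\<And>k. k \<le> n \<Longrightarrow> \<pi> k = 0"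
      by simp
    have "energy_level G \<pi> n = int n"
      using energy_level_const[OF IH, where G = G] by (simp add: G_def counting_game1_def)
    then have "\<pi> (Suc n) \<noteq> 1"
      using LU[of "Suc n"] Suc.prems IH[of n] by (auto simp: energy_level_Suc G_def counting_game1_def)
    then have "\<pi> (Suc n) = 0"
      using edge(2)[of n] IH[of n] by auto
    then show ?case
      using IH by (auto simp: le_Suc_eq)
  qed (simp add: edge)
  have "\<pi> (Suc U) \<noteq> 0"
  proof
    assume "\<pi> (Suc U) = 0"
    then have "\<And>k. k \<le> Suc U \<Longrightarrow> \<pi> k = 0"
      using zero[of U] by (auto simp: le_Suc_eq)
    from energy_level_const[OF this, where G = G] show False
      using LU[of "Suc U"] by (simp add: G_def counting_game1_def)
  qed
  then have leave: "\<pi> (Suc j) = 1 \<longleftrightarrow> j = U" if "j \<le> U" for j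
    using zero[of U] edge(2)[of U] that by (cases "j = U") auto
  have move: "next_move A (((\<lambda>m. update A m 0) ^^ j) (init_mem A)) 0 = \<pi> (Suc j)"
    if "j \<le> U" for j
  proof -
    have "prefix_upto \<pi> j = replicate j 0 @ [0]"
      using zero[OF that] prefix_upto_const[of j \<pi> 0] by (simp add: replicate_append_same)
    moreover have "\<pi> (Suc j) = moore_strategy A (prefix_upto \<pi> j)"
      using con zero[OF that] by (simp add: consistent_def G_def counting_game1_def)
    ultimately show ?thesis
      by (simp add: moore_strategy_def foldl_replicate)
  qed
  show ?thesis
  proof (rule counting_needs_memory)
    show "finite (memory A)" "init_mem A \<in> memory A"
      "\<And>m. m \<in> memory A \<Longrightarrow> update A m 0 \<in> memory A"
      using A(1) G(2) by (auto simp: is_moore_def)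
    show "next_move A (((\<lambda>m. update A m 0) ^^ j) (init_mem A)) 0 = 1 \<longleftrightarrow> j = U" if "j \<le> U" for j
      using move[OF that] leave[OF that] by simp
  qed
qed

text \<open>
  When player 1 leaves state 0 at energy level \<open>j\<close>, player 2 has to answer \<open>3\<close> if \<open>j = U\<close>, and
  \<open>2\<close> if \<open>j < U\<close>.
\<close>

definition counting_game2 :: "nat \<Rightarrow> nat game" where
  "counting_game2 U = \<lparr>states1 = {0, 2, 3}, states2 = {1},
     edges = {(0, 0), (0, 1), (1, 2), (1, 3), (2, 2), (3, 3)},
     weight = (\<lambda>e. if e = (0, 0) \<or> e = (1, 3) then 1 else if e = (1, 2) then - int U else 0)\<rparr>"

lemma is_game_counting_game2: "is_game (counting_game2 U)"
  by (auto simp: is_game_def counting_game2_def states_def)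

lemma counting_game2_win:
  "\<exists>\<sigma>. wins_with (counting_game2 U) Player2 0 (LowerUpper (counting_game2 U) U 0) \<sigma>"
proof -
  define G where "G = counting_game2 U"
  \<comment> \<open>Length \<open>U + 2\<close> means \<open>U + 1\<close> visits to 0 followed by
    state 1, that is, energy exactly \<open>U\<close>.\<close>
  define \<sigma> :: "nat list \<Rightarrow> nat" where "\<sigma> \<rho> = (if length \<rho> = U + 2 then 3 else 2)" for \<rho>
  have "is_strategy G Player2 0 \<sigma>"
    by (auto simp: is_strategy_def G_def counting_game2_def \<sigma>_def)
  moreover have "\<pi> \<notin> LowerUpper G U 0"
    if play: "is_play G 0 \<pi>" and con: "consistent G Player2 \<sigma> \<pi>" for \<pi>
  proof
    assume "\<pi> \<in> LowerUpper G U 0"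
    then have LU: "energy_level G \<pi> n \<in> {0..int U}" for n
      by (simp add: LowerUpper_def)
    have edge: "\<pi> 0 = 0" "(\<pi> n, \<pi> (Suc n)) \<in> edges G" for n
      using play by (simp_all add: is_play_def)
    \<comment> \<open>Staying in 0 for one step more than \<open>U\<close> would itself break the
      upper bound.\<close>
    have "\<exists>n\<le>Suc U. \<pi> n \<noteq> 0"
    proof (rule ccontr)
      assume "\<not> ?thesis"
      then have "\<And>k. k \<le> Suc U \<Longrightarrow> \<pi> k = 0"
        by blast
      from energy_level_const[OF this, where G = G] show False
        using LU[of "Suc U"] by (simp add: G_def counting_game2_def)
    qed
    then obtain n where n: "n \<le> Suc U" "\<pi> n \<noteq> 0" "\<And>k. k < n \<Longrightarrow> \<pi> k = 0"
      using exists_least_iff[of "\<lambda>n. n \<le> Suc U \<and> \<pi> n \<noteq> 0"]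
      by (metis less_imp_le_nat order_trans)
    then obtain j where j: "n = Suc j" "j \<le> U"
      using edge(1) by (cases n) auto
    have zero: "\<And>k. k \<le> j \<Longrightarrow> \<pi> k = 0"
      using n(3) j(1) by simp
    have one: "\<pi> (Suc j) = 1"
      using edge(2)[of j] zero[of j] n(2) j(1) by (auto simp: G_def counting_game2_def)
    have "energy_level G \<pi> (Suc j) = int j"
      using energy_level_const[OF zero, where G = G] zero[of j] one
      by (simp add: energy_level_Suc G_def counting_game2_def)
    moreover have "\<pi> (Suc (Suc j)) = (if j = U then 3 else 2)"
      using con one by (simp add: consistent_def G_def counting_game2_def \<sigma>_def)
    ultimately have "energy_level G \<pi> (Suc (Suc j)) = (if j = U then int U + 1 else int j - int U)"
      using one by (simp add: energy_level_Suc[of _ _ "Suc j"] G_def counting_game2_def)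
    then show False
      using LU[of "Suc (Suc j)"] j(2) by (auto split: if_splits)
  qed
  ultimately show ?thesis
    by (auto simp: wins_with_def G_def)
qed

text \<open>Player 1 may leave at any level \<open>j\<close> up to \<open>U\<close>. A wrong answer
  then keeps the energy within bounds forever, so the answers of a winning machine must tell
  \<open>j = U\<close> from all smaller levels.\<close>

lemma counting_game2_memory:
  assumes "fm_wins_with (counting_game2 U) Player2 0 (LowerUpper (counting_game2 U) U 0) A"
  shows "U + 1 \<le> card (memory A)"
proof -
  define G where "G = counting_game2 U"
  have A: "is_moore G Player2 A" "is_strategy G Player2 0 (moore_strategy A)"
    and win: "\<And>\<pi>. is_play G 0 \<pi> \<Longrightarrow> consistent G Player2 (moore_strategy A) \<pi> \<Longrightarrow>
      \<pi> \<notin> LowerUpper G U 0"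
    using assms by (auto simp: fm_wins_with_def wins_with_def G_def)
  \<comment> \<open>When state 1 is reached after \<open>j\<close> loops, \<open>j + 1\<close> zeros
    have been read, hence the extra update at the start.\<close>
  define mem where "mem j = ((\<lambda>m. update A m 0) ^^ j) (update A (init_mem A) 0)" for j
  have answer: "next_move A (mem j) 1 = 3 \<longleftrightarrow> j = U" if "j \<le> U" for j
  proof -
    define y where "y = next_move A (mem j) 1"
    \<comment> \<open>The play that leaves at level \<open>j\<close> and is answered by
      \<open>x\<close>. The machine sees the same prefix for every \<open>x\<close>, so its answer
      \<open>y\<close> can be inserted afterwards.\<close>
    define \<pi> :: "nat \<Rightarrow> nat \<Rightarrow> nat"
      where "\<pi> x n = (if n \<le> j then 0 else if n = Suc j then 1 else x)" for x n
    have play: "is_play G 0 (\<pi> x)" if "x \<in> {2, 3}" for x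
      using that by (auto simp: is_play_def \<pi>_def G_def counting_game2_def)
    have prefix: "prefix_upto (\<pi> x) (Suc j) = replicate (Suc j) 0 @ [1]" for x
      using prefix_upto_const[of j "\<pi> x" 0] by (simp add: prefix_upto_Suc \<pi>_def)
    have strat: "moore_strategy A (prefix_upto (\<pi> x) (Suc j)) = y" for x
      unfolding prefix moore_strategy_def y_def mem_def
      by (simp add: foldl_replicate funpow_Suc_right del: replicate_Suc funpow.simps(2))
    have y: "y \<in> {2, 3}"
      using A(2)[unfolded is_strategy_def, rule_format, of "\<pi> 2" "Suc j"] play[of 2] strat[of 2]
      by (simp add: \<pi>_def G_def counting_game2_def)
    have "n = Suc j" if "\<pi> y n \<in> owned G Player2" for n
      using that y by (auto simp: \<pi>_def G_def counting_game2_def split: if_splits)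
    then have "consistent G Player2 (moore_strategy A) (\<pi> y)"
      using strat[of y] unfolding consistent_def by (metis \<pi>_def Suc_n_not_le_n n_not_Suc_n le_SucI order_refl)
    then have lose: "\<pi> y \<notin> LowerUpper G U 0"
      using win play[OF y] by blast
    have "energy_level G (\<pi> y) n = (if n \<le> j then int n else if n = Suc j then int j
        else if y = 2 then int j - int U else int j + 1)" for n
    proof (induction n)
      case (Suc n)
      then show ?case
        using y by (auto simp: energy_level_Suc \<pi>_def G_def counting_game2_def)
    qed simp
    then have "y = 3 \<Longrightarrow> j < U \<Longrightarrow> \<pi> y \<in> LowerUpper G U 0" "y = 2 \<Longrightarrow> j = U \<Longrightarrow> \<pi> y \<in> LowerUpper G U 0"
      by (auto simp: LowerUpper_def)
    then show ?thesis
      using lose y that unfolding y_def by (metis insertE le_neq_implies_less singletonD)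
  qed
  have states: "0 \<in> states G"
    by (simp add: G_def states_def counting_game2_def)
  show ?thesis
  proof (rule counting_needs_memory)
    show "finite (memory A)" "update A (init_mem A) 0 \<in> memory A"
      "\<And>m. m \<in> memory A \<Longrightarrow> update A m 0 \<in> memory A"
      using A(1) states by (auto simp: is_moore_def)
    show "next_move A (((\<lambda>m. update A m 0) ^^ j) (update A (init_mem A) 0)) 1 = 3 \<longleftrightarrow> j = U"
      if "j \<le> U" for j
      using answer[OF that] by (simp add: mem_def)
  qed
qed

text \<open>In each game a single weight depends on \<open>U\<close>, so the binary size grows only
  like the bit length of \<open>U\<close>.\<close>

lemma game_size_counting_games:
  "game_size (counting_game1 U) \<le> 20 + nat (bitlen (int U))"
  "game_size (counting_game2 U) \<le> 20 + nat (bitlen (int U))"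
proof -
  have bits: "int_bits 0 = 1" "int_bits 1 = 2"
    by (simp_all add: int_bits_def bitlen_alt_def)
  have 1: "states (counting_game1 U) = {0, 1}" "states (counting_game2 U) = {0, 1, 2, 3}"
    by (auto simp: states_def counting_game1_def counting_game2_def)
  have 2: "int_bits (- int U) = 1 + nat (bitlen (int U))"
    by (simp add: int_bits_def)
  show "game_size (counting_game1 U) \<le> 20 + nat (bitlen (int U))"
    unfolding game_size_def 1 by (simp add: counting_game1_def bits 2)
  show "game_size (counting_game2 U) \<le> 20 + nat (bitlen (int U))"
    unfolding game_size_def 1 by (simp add: counting_game2_def bits 2)
qed

text \<open>The bound \<open>max 1 (int U)\<close> is there for \<open>U = 0\<close>, where the
  counting loop still has weight 1.\<close>

lemma lower_bound_family:
  "\<exists>(G :: nat \<Rightarrow> nat game) s k. \<forall>U. is_game (G U) \<and> s \<in> states (G U) \<and> card (states (G U)) = k \<and>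
     (\<forall>e\<in>edges (G U). \<bar>weight (G U) e\<bar> \<le> max 1 (int U)) \<and>
     game_size (G U) \<le> 20 + nat (bitlen (int U)) \<and>
     (\<exists>\<sigma>. wins_with (G U) i s (LowerUpper (G U) U 0) \<sigma>) \<and>
     (\<forall>A. fm_wins_with (G U) i s (LowerUpper (G U) U 0) A \<longrightarrow> U + 1 \<le> card (memory A))"
proof (cases i)
  case Player1
  show ?thesis
    unfolding Player1
    by (rule exI[of _ counting_game1], rule exI[of _ 0], rule exI[of _ 2])
      (use is_game_counting_game1 counting_game1_win counting_game1_memory game_size_counting_games
        in \<open>auto simp: counting_game1_def states_def\<close>)
next
  case Player2
  show ?thesis
    unfolding Player2
    by (rule exI[of _ counting_game2], rule exI[of _ 0], rule exI[of _ 4])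
      (use is_game_counting_game2 counting_game2_win counting_game2_memory game_size_counting_games
        in \<open>auto simp: counting_game2_def states_def\<close>)
qed

section \<open>Polynomials\<close>

lemma poly_mono_nat: "x \<le> y \<Longrightarrow> poly p x \<le> poly p y" for p :: "nat poly"
  by (induction p) (auto intro!: add_mono mult_mono)

lemma power_over_exp2: "(\<lambda>n. real (n ^ k) / 2 ^ n) \<longlonglongrightarrow> 0"
proof -
  have "filterlim (\<lambda>n. real n * ln 2) at_top sequentially"
    by (intro filterlim_at_top_mult_tendsto_pos[OF tendsto_const] filterlim_real_sequentially) simp
  from filterlim_compose[OF tendsto_power_div_exp_0[of k] this]
  have "(\<lambda>n. 1 / ln 2 ^ k * ((real n * ln 2) ^ k / exp (real n * ln 2))) \<longlonglongrightarrow> 1 / ln 2 ^ k * 0"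
    by (intro tendsto_mult tendsto_const)
  moreover have "1 / ln 2 ^ k * ((real n * ln 2) ^ k / exp (real n * ln 2)) = real (n ^ k) / 2 ^ n" for n
    by (simp add: power_mult_distrib exp_of_nat_mult)
  ultimately show ?thesis
    by simp
qed

text \<open>The factor \<open>n ^ k\<close> is carried along for the induction: the tail of
  \<open>pCons a p\<close> comes multiplied by one more \<open>n\<close>, which moves into the
  power.\<close>

lemma poly_over_exp2: "(\<lambda>n. real (n ^ k * poly p n) / 2 ^ n) \<longlonglongrightarrow> 0" for p :: "nat poly"
proof (induction p arbitrary: k)
  case (pCons a p)
  have "(\<lambda>n. real a * (real (n ^ k) / 2 ^ n) + real (n ^ Suc k * poly p n) / 2 ^ n) \<longlonglongrightarrow>
      real a * 0 + 0"
    by (intro tendsto_add tendsto_mult tendsto_const power_over_exp2 pCons.IH)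
  moreover have "real a * (real (n ^ k) / 2 ^ n) + real (n ^ Suc k * poly p n) / 2 ^ n =
      real (n ^ k * poly (pCons a p) n) / 2 ^ n" for n
    by (simp add: field_simps)
  ultimately show ?case
    by simp
qed simp

lemma poly_bitlen_less:
  "\<forall>\<^sub>F U in sequentially. poly p (a + b * nat (bitlen (int U))) < U" for p :: "nat poly"
proof -
  define q where "q = pcompose p [:a, b:]"
  \<comment> \<open>The constant is 1/2 because a number with \<open>n\<close> bits may be as small
    as \<open>2 ^ (n - 1)\<close>.\<close>
  have "\<forall>\<^sub>F n in sequentially. real (n ^ 0 * poly q n) / 2 ^ n < 1 / 2"
    using poly_over_exp2[of 0 q] by (rule order_tendstoD) simp
  then obtain N where N: "\<And>n. n \<ge> N \<Longrightarrow> real (poly q n) / 2 ^ n < 1 / 2"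
    by (auto simp: eventually_sequentially)
  have "poly p (a + b * nat (bitlen (int U))) < U" if "U \<ge> 2 ^ N" for U
  proof -
    define n where "n = nat (bitlen (int U))"
    have "1 \<le> U"
      using that by (metis one_le_numeral one_le_power order_trans)
    then have n: "(2::int) ^ (n - 1) \<le> int U" "int U < 2 ^ n"
      using bitlen_bounds[of "int U"] by (simp_all add: n_def nat_diff_distrib' bitlen_nonneg)
    have "(2::nat) ^ N < 2 ^ n"
      using that n(2) by (metis le_less_trans of_nat_less_iff of_nat_numeral of_nat_power)
    then have "N < n"
      by simp
    then have "real (poly q n) < 2 ^ (n - 1)"
      using N[of n] by (cases n) (simp_all add: field_simps)
    also have "(2::real) ^ (n - 1) \<le> real U"
      using n(1) by (metis of_int_le_iff of_int_numeral of_int_of_nat_eq of_int_power)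
    finally show ?thesis
      by (simp add: q_def poly_pcompose n_def mult.commute)
  qed
  then show ?thesis
    unfolding eventually_sequentially by blast
qed

section \<open>Memory bounds\<close>

lemma LowerUpper_subset_AvgEnergy: "LowerUpper G U 0 \<subseteq> AvgEnergy G (real U)"
proof
  fix \<pi>
  assume "\<pi> \<in> LowerUpper G U 0"
  then have "energy_level G \<pi> n \<le> int U" for n
    by (simp add: LowerUpper_def)
  then have "real_of_int (energy_level G \<pi> n) \<le> real U" for n
    by (metis of_int_le_iff of_int_of_nat_eq)
  then have "average_energy G \<pi> \<le> ereal (real U)"
    unfolding average_energy_def
    by (intro average_le_of_potential[where h = "\<lambda>_. 0"]) simp_all
  then show "\<pi> \<in> AvgEnergy G (real U)"
    by (simp add: AvgEnergy_def)
qed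

text \<open>The threshold \<open>U\<close> on the average energy is vacuous for energy levels in \<open>{0..U}\<close>.\<close>

lemma memory_lower_bound:
  "\<exists>(G :: nat \<Rightarrow> nat game) s k.
     (\<forall>U\<ge>1. is_game (G U) \<and> s \<in> states (G U) \<and> card (states (G U)) = k \<and>
        (\<forall>e\<in>edges (G U). \<bar>weight (G U) e\<bar> \<le> int U) \<and>
        (\<exists>\<sigma>. wins_with (G U) i s (LowerUpper (G U) U 0) \<sigma>) \<and>
        (\<forall>A. fm_wins_with (G U) i s (LowerUpper (G U) U 0) A \<longrightarrow>
           1 * real U \<le> real (card (memory A)))) \<and>
     (\<forall>p :: nat poly. \<forall>\<^sub>F U in sequentially.
        \<forall>A. fm_wins_with (G U) i s (LowerUpper (G U) U 0) A \<longrightarrow>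
           poly p (game_size (G U) + int_bits (int U) + rat_bits (of_nat U)) < card (memory A)) \<and>
     (\<forall>U. LowerUpper (G U) U 0 \<inter> AvgEnergy (G U) (of_rat (of_nat U)) = LowerUpper (G U) U 0)"
proof -
  obtain G :: "nat \<Rightarrow> nat game" and s k where
    G: "\<And>U. is_game (G U) \<and> s \<in> states (G U) \<and> card (states (G U)) = k \<and>
      (\<exists>\<sigma>. wins_with (G U) i s (LowerUpper (G U) U 0) \<sigma>)"
    and weight: "\<And>U e. e \<in> edges (G U) \<Longrightarrow> \<bar>weight (G U) e\<bar> \<le> max 1 (int U)"
    and size: "\<And>U. game_size (G U) \<le> 20 + nat (bitlen (int U))"
    and lower: "\<And>U A. fm_wins_with (G U) i s (LowerUpper (G U) U 0) A \<Longrightarrow> U + 1 \<le> card (memory A)"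
    using lower_bound_family[of i] by metis
  have "\<forall>\<^sub>F U in sequentially. \<forall>A. fm_wins_with (G U) i s (LowerUpper (G U) U 0) A \<longrightarrow>
      poly p (game_size (G U) + int_bits (int U) + rat_bits (of_nat U)) < card (memory A)"
    for p :: "nat poly"
    \<comment> \<open>With \<open>b\<close> the bit length of \<open>U\<close>, the game contributes
      at most \<open>20 + b\<close>, the bound \<open>1 + b\<close>, and the threshold
      \<open>U / 1\<close> another \<open>(1 + b) + 2\<close>.\<close>
    using poly_bitlen_less[of p 24 3]
  proof eventually_elim
    case (elim U)
    have "poly p (game_size (G U) + int_bits (int U) + rat_bits (of_nat U)) \<le>
        poly p (24 + 3 * nat (bitlen (int U)))"
      using size[of U] by (intro poly_mono_nat) (simp add: int_bits_def rat_bits_def bitlen_alt_def)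
    then show ?case
      using elim lower[of U] by fastforce
  qed
  moreover have "LowerUpper (G U) U 0 \<inter> AvgEnergy (G U) (of_rat (of_nat U)) = LowerUpper (G U) U 0"
    for U
    using LowerUpper_subset_AvgEnergy[of "G U" U] by auto
  moreover have "\<bar>weight (G U) e\<bar> \<le> int U" if "U \<ge> 1" "e \<in> edges (G U)" for U e
    using weight[OF that(2)] that(1) by simp
  moreover have "1 * real U \<le> real (card (memory A))"
    if "fm_wins_with (G U) i s (LowerUpper (G U) U 0) A" for U A
    using lower[OF that] by simp
  ultimately show ?thesis
    using G by blast
qed

theorem theorem7:
  shows
    "(\<exists>P :: nat poly poly. \<forall>(G :: 'a game) s U W i.
        is_game G \<and> s \<in> states G \<and> W \<in> bounded_objectives G U \<and> (\<exists>\<sigma>. wins_with G i s W \<sigma>) \<longrightarrow>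
        (\<exists>A. fm_wins_with G i s W A \<and> card (memory A) \<le> poly2 P (card (states G)) U))
   \<and>
     (\<forall>i. \<exists>(G :: nat \<Rightarrow> nat game) s k c. c > 0 \<and>
        (\<forall>U\<ge>1. is_game (G U) \<and> s U \<in> states (G U) \<and> card (states (G U)) = k \<and>
           (\<forall>e\<in>edges (G U). \<bar>weight (G U) e\<bar> \<le> int U) \<and>
           (\<exists>\<sigma>. wins_with (G U) i (s U) (LowerUpper (G U) U 0) \<sigma>) \<and>
           (\<forall>A. fm_wins_with (G U) i (s U) (LowerUpper (G U) U 0) A \<longrightarrow>
              c * real U \<le> real (card (memory A)))) \<and>
        (\<forall>p :: nat poly. \<forall>\<^sub>F U in sequentially.
           \<forall>A. fm_wins_with (G U) i (s U) (LowerUpper (G U) U 0) A \<longrightarrow>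
              poly p (game_size (G U) + int_bits (int U)) < card (memory A)))
   \<and>
     (\<forall>i. \<exists>(G :: nat \<Rightarrow> nat game) s (t :: nat \<Rightarrow> rat) k c. c > 0 \<and>
        (\<forall>U\<ge>1. is_game (G U) \<and> s U \<in> states (G U) \<and> card (states (G U)) = k \<and>
           (\<forall>e\<in>edges (G U). \<bar>weight (G U) e\<bar> \<le> int U) \<and>
           (\<exists>\<sigma>. wins_with (G U) i (s U)
              (LowerUpper (G U) U 0 \<inter> AvgEnergy (G U) (of_rat (t U))) \<sigma>) \<and>
           (\<forall>A. fm_wins_with (G U) i (s U)
                (LowerUpper (G U) U 0 \<inter> AvgEnergy (G U) (of_rat (t U))) A \<longrightarrow>
              c * real U \<le> real (card (memory A)))) \<and>
        (\<forall>p :: nat poly. \<forall>\<^sub>F U in sequentially.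
           \<forall>A. fm_wins_with (G U) i (s U)
                (LowerUpper (G U) U 0 \<inter> AvgEnergy (G U) (of_rat (t U))) A \<longrightarrow>
              poly p (game_size (G U) + int_bits (int U) + rat_bits (t U)) < card (memory A)))
   \<and>
     (\<forall>q :: nat poly. \<exists>p :: nat poly. \<forall>(G :: 'a game) s U W i.
        is_game G \<and> s \<in> states G \<and> W \<in> bounded_objectives G U \<and> (\<exists>\<sigma>. wins_with G i s W \<sigma>) \<and>
        U \<le> poly q (game_size G) \<longrightarrow>
        (\<exists>A. fm_wins_with G i s W A \<and> card (memory A) \<le> poly p (game_size G)))
   \<and>
     (\<exists>p :: nat poly. \<forall>(G :: 'a game) s U W i.
        is_game G \<and> s \<in> states G \<and> W \<in> bounded_objectives G U \<and> (\<exists>\<sigma>. wins_with G i s W \<sigma>) \<longrightarrow>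
        (\<exists>A. fm_wins_with G i s W A \<and> card (memory A) \<le> poly p (game_size G + U)))"
proof (intro conjI)
  show "\<exists>P :: nat poly poly. \<forall>(G :: 'a game) s U W i.
      is_game G \<and> s \<in> states G \<and> W \<in> bounded_objectives G U \<and> (\<exists>\<sigma>. wins_with G i s W \<sigma>) \<longrightarrow>
      (\<exists>A. fm_wins_with G i s W A \<and> card (memory A) \<le> poly2 P (card (states G)) U)"
  \<comment> \<open>The outer variable is the number of states, the inner one
    \<open>U\<close>.\<close>
  proof (intro exI[of _ "[: [:2:], [:1, 1:] :]"] allI impI)
    fix G :: "'a game" and s U W i
    assume "is_game G \<and> s \<in> states G \<and> W \<in> bounded_objectives G U \<and> (\<exists>\<sigma>. wins_with G i s W \<sigma>)"
    moreover have "poly2 [: [:2:], [:1, 1:] :] (card (states G)) U = card (states G) * (U + 1) + 2"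
      by (simp add: poly2_def algebra_simps)
    ultimately show "\<exists>A. fm_wins_with G i s W A \<and>
        card (memory A) \<le> poly2 [: [:2:], [:1, 1:] :] (card (states G)) U"
      using finite_memory_suffices[of G s W U i] by fastforce
  qed
next
  show "\<exists>p :: nat poly. \<forall>(G :: 'a game) s U W i.
      is_game G \<and> s \<in> states G \<and> W \<in> bounded_objectives G U \<and> (\<exists>\<sigma>. wins_with G i s W \<sigma>) \<longrightarrow>
      (\<exists>A. fm_wins_with G i s W A \<and> card (memory A) \<le> poly p (game_size G + U))"
  \<comment> \<open>This is \<open>z * (z + 1) + 2\<close> at
    \<open>z = game_size G + U\<close>.\<close>
  proof (intro exI[of _ "[:2, 1, 1:]"] allI impI)
    fix G :: "'a game" and s U W i
    assume *: "is_game G \<and> s \<in> states G \<and> W \<in> bounded_objectives G U \<and> (\<exists>\<sigma>. wins_with G i s W \<sigma>)"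
    have "card (states G) * (U + 1) \<le> (game_size G + U) * (game_size G + U + 1)"
      by (intro mult_le_mono) (simp_all add: game_size_def)
    then show "\<exists>A. fm_wins_with G i s W A \<and> card (memory A) \<le> poly [:2, 1, 1:] (game_size G + U)"
      using finite_memory_suffices[of G s W U i] * by (fastforce simp: algebra_simps)
  qed
next
  show "\<forall>q :: nat poly. \<exists>p :: nat poly. \<forall>(G :: 'a game) s U W i.
      is_game G \<and> s \<in> states G \<and> W \<in> bounded_objectives G U \<and> (\<exists>\<sigma>. wins_with G i s W \<sigma>) \<and>
      U \<le> poly q (game_size G) \<longrightarrow>
      (\<exists>A. fm_wins_with G i s W A \<and> card (memory A) \<le> poly p (game_size G))"
  proof
    fix q :: "nat poly"
    let ?p = "[:0, 1:] * (q + 1) + [:2:]"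
    show "\<exists>p :: nat poly. \<forall>(G :: 'a game) s U W i.
      is_game G \<and> s \<in> states G \<and> W \<in> bounded_objectives G U \<and> (\<exists>\<sigma>. wins_with G i s W \<sigma>) \<and>
      U \<le> poly q (game_size G) \<longrightarrow>
      (\<exists>A. fm_wins_with G i s W A \<and> card (memory A) \<le> poly p (game_size G))"
    proof (intro exI[of _ ?p] allI impI)
      fix G :: "'a game" and s U W i
      assume *: "is_game G \<and> s \<in> states G \<and> W \<in> bounded_objectives G U \<and>
        (\<exists>\<sigma>. wins_with G i s W \<sigma>) \<and> U \<le> poly q (game_size G)"
      have "card (states G) * (U + 1) \<le> game_size G * (poly q (game_size G) + 1)"
        using * by (intro mult_le_mono) (simp_all add: game_size_def)
      then show "\<exists>A. fm_wins_with G i s W A \<and> card (memory A) \<le> poly ?p (game_size G)"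
        using finite_memory_suffices[of G s W U i] * by (fastforce simp: algebra_simps)
    qed
  qed
next
  show "\<forall>i. \<exists>(G :: nat \<Rightarrow> nat game) s k c. c > 0 \<and>
         (\<forall>U\<ge>1. is_game (G U) \<and> s U \<in> states (G U) \<and> card (states (G U)) = k \<and>
            (\<forall>e\<in>edges (G U). \<bar>weight (G U) e\<bar> \<le> int U) \<and>
            (\<exists>\<sigma>. wins_with (G U) i (s U) (LowerUpper (G U) U 0) \<sigma>) \<and>
            (\<forall>A. fm_wins_with (G U) i (s U) (LowerUpper (G U) U 0) A \<longrightarrow>
               c * real U \<le> real (card (memory A)))) \<and>
         (\<forall>p :: nat poly. \<forall>\<^sub>F U in sequentially.
            \<forall>A. fm_wins_with (G U) i (s U) (LowerUpper (G U) U 0) A \<longrightarrow>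
               poly p (game_size (G U) + int_bits (int U)) < card (memory A))"
  proof
    fix i
    show "\<exists>(G :: nat \<Rightarrow> nat game) s k c. c > 0 \<and>
         (\<forall>U\<ge>1. is_game (G U) \<and> s U \<in> states (G U) \<and> card (states (G U)) = k \<and>
            (\<forall>e\<in>edges (G U). \<bar>weight (G U) e\<bar> \<le> int U) \<and>
            (\<exists>\<sigma>. wins_with (G U) i (s U) (LowerUpper (G U) U 0) \<sigma>) \<and>
            (\<forall>A. fm_wins_with (G U) i (s U) (LowerUpper (G U) U 0) A \<longrightarrow>
               c * real U \<le> real (card (memory A)))) \<and>
         (\<forall>p :: nat poly. \<forall>\<^sub>F U in sequentially.
            \<forall>A. fm_wins_with (G U) i (s U) (LowerUpper (G U) U 0) A \<longrightarrow>
               poly p (game_size (G U) + int_bits (int U)) < card (memory A))"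
    proof -
      obtain G :: "nat \<Rightarrow> nat game" and s k where G: "\<And>U. U \<ge> 1 \<Longrightarrow>
          is_game (G U) \<and> s \<in> states (G U) \<and> card (states (G U)) = k \<and>
          (\<forall>e\<in>edges (G U). \<bar>weight (G U) e\<bar> \<le> int U) \<and>
          (\<exists>\<sigma>. wins_with (G U) i s (LowerUpper (G U) U 0) \<sigma>) \<and>
          (\<forall>A. fm_wins_with (G U) i s (LowerUpper (G U) U 0) A \<longrightarrow>
             1 * real U \<le> real (card (memory A)))"
        and lower: "\<And>p :: nat poly. \<forall>\<^sub>F U in sequentially.
          \<forall>A. fm_wins_with (G U) i s (LowerUpper (G U) U 0) A \<longrightarrow>
             poly p (game_size (G U) + int_bits (int U) + rat_bits (of_nat U)) < card (memory A)"
        using memory_lower_bound[of i] by blast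
      have "\<forall>\<^sub>F U in sequentially. \<forall>A. fm_wins_with (G U) i s (LowerUpper (G U) U 0) A \<longrightarrow>
          poly p (game_size (G U) + int_bits (int U)) < card (memory A)" for p :: "nat poly"
        using lower[of p] by eventually_elim (meson le_add1 le_less_trans poly_mono_nat)
      then show ?thesis
        using G by (intro exI[of _ G] exI[of _ "\<lambda>_. s"] exI[of _ k] exI[of _ 1]) simp
    qed
  qed
next
  show "\<forall>i. \<exists>(G :: nat \<Rightarrow> nat game) s (t :: nat \<Rightarrow> rat) k c. c > 0 \<and>
        (\<forall>U\<ge>1. is_game (G U) \<and> s U \<in> states (G U) \<and> card (states (G U)) = k \<and>
           (\<forall>e\<in>edges (G U). \<bar>weight (G U) e\<bar> \<le> int U) \<and>
           (\<exists>\<sigma>. wins_with (G U) i (s U)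
              (LowerUpper (G U) U 0 \<inter> AvgEnergy (G U) (of_rat (t U))) \<sigma>) \<and>
           (\<forall>A. fm_wins_with (G U) i (s U)
                (LowerUpper (G U) U 0 \<inter> AvgEnergy (G U) (of_rat (t U))) A \<longrightarrow>
              c * real U \<le> real (card (memory A)))) \<and>
        (\<forall>p :: nat poly. \<forall>\<^sub>F U in sequentially.
           \<forall>A. fm_wins_with (G U) i (s U)
                (LowerUpper (G U) U 0 \<inter> AvgEnergy (G U) (of_rat (t U))) A \<longrightarrow>
              poly p (game_size (G U) + int_bits (int U) + rat_bits (t U)) < card (memory A))"
  proof
    fix i
    show "\<exists>(G :: nat \<Rightarrow> nat game) s (t :: nat \<Rightarrow> rat) k c. c > 0 \<and>
        (\<forall>U\<ge>1. is_game (G U) \<and> s U \<in> states (G U) \<and> card (states (G U)) = k \<and>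
           (\<forall>e\<in>edges (G U). \<bar>weight (G U) e\<bar> \<le> int U) \<and>
           (\<exists>\<sigma>. wins_with (G U) i (s U)
              (LowerUpper (G U) U 0 \<inter> AvgEnergy (G U) (of_rat (t U))) \<sigma>) \<and>
           (\<forall>A. fm_wins_with (G U) i (s U)
                (LowerUpper (G U) U 0 \<inter> AvgEnergy (G U) (of_rat (t U))) A \<longrightarrow>
              c * real U \<le> real (card (memory A)))) \<and>
        (\<forall>p :: nat poly. \<forall>\<^sub>F U in sequentially.
           \<forall>A. fm_wins_with (G U) i (s U)
                (LowerUpper (G U) U 0 \<inter> AvgEnergy (G U) (of_rat (t U))) A \<longrightarrow>
              poly p (game_size (G U) + int_bits (int U) + rat_bits (t U)) < card (memory A))"
    proof -
      obtain G :: "nat \<Rightarrow> nat game" and s k where G: "\<And>U. U \<ge> 1 \<Longrightarrow>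
          is_game (G U) \<and> s \<in> states (G U) \<and> card (states (G U)) = k \<and>
          (\<forall>e\<in>edges (G U). \<bar>weight (G U) e\<bar> \<le> int U) \<and>
          (\<exists>\<sigma>. wins_with (G U) i s (LowerUpper (G U) U 0) \<sigma>) \<and>
          (\<forall>A. fm_wins_with (G U) i s (LowerUpper (G U) U 0) A \<longrightarrow>
             1 * real U \<le> real (card (memory A)))"
        and lower: "\<And>p :: nat poly. \<forall>\<^sub>F U in sequentially.
          \<forall>A. fm_wins_with (G U) i s (LowerUpper (G U) U 0) A \<longrightarrow>
             poly p (game_size (G U) + int_bits (int U) + rat_bits (of_nat U)) < card (memory A)"
        and vacuous: "\<And>U. LowerUpper (G U) U 0 \<inter> AvgEnergy (G U) (of_rat (of_nat U)) =
          LowerUpper (G U) U 0"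
        using memory_lower_bound[of i] by blast
      show ?thesis
        \<comment> \<open>The threshold is \<open>t U = U\<close>; the simplification rule is
          removed so that the goal keeps the form of \<open>vacuous\<close>.\<close>
        using G lower
        by (intro exI[of _ G] exI[of _ "\<lambda>_. s"] exI[of _ of_nat] exI[of _ k] exI[of _ 1])
          (simp add: vacuous del: of_rat_of_nat_eq)
    qed
  qed
qed

end
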